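(* Let $n\ge 2$, let $X_1,\dots,X_n$ be independent real random variables with absolutely continuous distributions $F_1,\dots,F_n$, and let $\sigma$ be a uniformly random permutation of $\{1,\dots,n\}$ independent of the prices, with prices presented in the order $X_{\sigma(1)},\dots,X_{\sigma(n)}$. Then there exists a threshold $T\in\mathbb{R}$ such that $\mathbb{E}(\mathrm{ALG}_T)\ge \frac{1}{16}\,\mathbb{E}(\mathrm{OPT})$. Moreover, such a threshold $T$ can be computed in polynomial time.
   Context: Trading-prophet problem in random order: there are $n$ periods; in period $i$ the price $X_{\sigma(i)}$ is revealed. An agent starts in period 1 without the item and can hold at most one unit of it. In each period, immediately after observing the price $p$, the agent may buy the item (reward $-p$) if she does not hold it, sell it (reward $+p$) if she holds it, or pass. The profit of an algorithm is its total reward; expectations are over the prices and $\sigma$. $\mathrm{OPT}$ is the maximum total reward over all buy/sell decision sequences given full knowledge of the realized price sequence (and $\sigma$). For $T\in\mathbb{R}$, $\mathrm{ALG}_T$ is the online algorithm which in each period $i<n$ buys if it does not hold the item and the price is $<T$, sells if it holds the item and the price is $\ge T$, and in period $n$ sells if it holds the item.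
   Formalization: OPT ranges only over sequences not ending with the item unsold (same for nonnegative prices; else false, e.g. prices near -1); prices have finite means; polynomial time = steps of a real RAM with unit-cost mean, cdf and quantile queries, one program per sample-space type. *)

theory Defs
  imports "HOL-Probability.Probability" "HOL-Combinatorics.Permutations"
begin

section \<open>Trading one item over the periods 1, ..., n\<close>

datatype action = Buy | Sell | Pass

fun reward :: "action \<Rightarrow> real \<Rightarrow> real" where
  "reward Buy p = - p"
| "reward Sell p = p"
| "reward Pass p = 0"

fun held_after :: "action \<Rightarrow> bool \<Rightarrow> bool" where
  "held_after Buy h = True"
| "held_after Sell h = False"
| "held_after Pass h = h"

primrec holding :: "(nat \<Rightarrow> action) \<Rightarrow> nat \<Rightarrow> bool" where
  "holding a 0 = False"
| "holding a (Suc i) = held_after (a (Suc i)) (holding a i)"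

definition feasible :: "nat \<Rightarrow> (nat \<Rightarrow> action) \<Rightarrow> bool" where
  "feasible n a \<longleftrightarrow>
     (\<forall>i\<in>{1..n}. (a i = Buy \<longrightarrow> \<not> holding a (i - 1)) \<and> (a i = Sell \<longrightarrow> holding a (i - 1)))"

definition total_reward :: "nat \<Rightarrow> (nat \<Rightarrow> action) \<Rightarrow> (nat \<Rightarrow> real) \<Rightarrow> real" where
  "total_reward n a p = (\<Sum>i=1..n. reward (a i) (p i))"

text \<open>
  Decision sequences range over those that do not end with an unsold item. Prices may be negative,
  and without this requirement the offline optimum could collect \<open>- p\<close> by buying at a negative
  price \<open>p\<close> and keeping the item, which no threshold algorithm (they all sell in period \<open>n\<close>) can
  match. For nonnegative prices the requirement makes no difference, see \<open>OPT_nonneg\<close> below.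
\<close>

definition OPT :: "nat \<Rightarrow> (nat \<Rightarrow> real) \<Rightarrow> real" where
  "OPT n p = Max ((\<lambda>a. total_reward n a p) ` {a. feasible n a \<and> \<not> holding a n})"

definition threshold_step :: "nat \<Rightarrow> real \<Rightarrow> nat \<Rightarrow> bool \<Rightarrow> real \<Rightarrow> action" where
  "threshold_step n T i h p =
     (if i < n then (if \<not> h \<and> p < T then Buy else if h \<and> p \<ge> T then Sell else Pass)
      else (if h then Sell else Pass))"

primrec threshold_holding :: "nat \<Rightarrow> real \<Rightarrow> (nat \<Rightarrow> real) \<Rightarrow> nat \<Rightarrow> bool" where
  "threshold_holding n T p 0 = False"
| "threshold_holding n T p (Suc i) =
     held_after (threshold_step n T (Suc i) (threshold_holding n T p i) (p (Suc i)))
       (threshold_holding n T p i)"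

definition threshold_actions :: "nat \<Rightarrow> real \<Rightarrow> (nat \<Rightarrow> real) \<Rightarrow> nat \<Rightarrow> action" where
  "threshold_actions n T p i = threshold_step n T i (threshold_holding n T p (i - 1)) (p i)"

definition ALG :: "nat \<Rightarrow> real \<Rightarrow> (nat \<Rightarrow> real) \<Rightarrow> real" where
  "ALG n T p = total_reward n (threshold_actions n T p) p"

lemma holding_threshold_actions: "holding (threshold_actions n T p) i = threshold_holding n T p i"
  by (induction i) (simp_all add: threshold_actions_def)

lemma feasible_threshold_actions: "feasible n (threshold_actions n T p)"
  by (auto simp: feasible_def holding_threshold_actions threshold_actions_def threshold_step_def
      split: if_splits)

lemma holding_cong: "(\<And>i. i \<in> {1..n} \<Longrightarrow> a i = b i) \<Longrightarrow> holding a n = holding b n"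
  by (induction n) auto

lemma feasible_cong:
  assumes "\<And>i. i \<in> {1..n} \<Longrightarrow> a i = b i"
  shows "feasible n a = feasible n b"
proof -
  have "holding a (i - 1) = holding b (i - 1)" if "i \<in> {1..n}" for i
    using that assms by (intro holding_cong) auto
  then show ?thesis using assms by (auto simp: feasible_def)
qed

lemma finite_total_reward: "finite ((\<lambda>a. total_reward n a p) ` A)"
proof -
  have fin: "finite (UNIV :: action set)"
  proof (rule finite_subset)
    show "UNIV \<subseteq> {Buy, Sell, Pass}" using action.exhaust by blast
  qed simp
  have "(\<lambda>a. total_reward n a p) ` A \<subseteq> (\<lambda>a. total_reward n a p) ` ({1..n} \<rightarrow>\<^sub>E UNIV)"
  proof
    fix x assume "x \<in> (\<lambda>a. total_reward n a p) ` A"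
    then obtain a where "x = total_reward n a p" by auto
    then have "x = total_reward n (restrict a {1..n}) p" by (simp add: total_reward_def)
    then show "x \<in> (\<lambda>a. total_reward n a p) ` ({1..n} \<rightarrow>\<^sub>E UNIV)"
      using image_eqI[of x "\<lambda>a. total_reward n a p" "restrict a {1..n}"] by (simp add: PiE_iff)
  qed
  moreover have "finite ({1..n} \<rightarrow>\<^sub>E (UNIV :: action set))"
    using fin by (intro finite_PiE) auto
  ultimately show ?thesis by (meson finite_imageI finite_subset)
qed

lemma drop_unsold_item:
  assumes "\<And>i. i \<in> {1..n} \<Longrightarrow> 0 \<le> p i" "feasible n a"
  shows "\<exists>b. feasible n b \<and> \<not> holding b n \<and> total_reward n a p \<le> total_reward n b p"
  using assms
proof (induction n)
  case 0
  then show ?case by auto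
next
  case (Suc n)
  show ?case
  proof (cases "holding a (Suc n)")
    case False
    with Suc.prems show ?thesis by blast
  next
    case True
    have fa: "feasible n a" using Suc.prems(2) by (auto simp: feasible_def)
    have "\<And>i. i \<in> {1..n} \<Longrightarrow> 0 \<le> p i" using Suc.prems(1) by simp
    from Suc.IH[OF this fa] obtain b where b: "feasible n b" "\<not> holding b n"
      "total_reward n a p \<le> total_reward n b p" by blast
    define c where "c = b(Suc n := Pass)"
    have cb: "c i = b i" if "i \<in> {1..n}" for i using that by (simp add: c_def)
    have "feasible n c" "\<not> holding c n"
      using b feasible_cong[of n c b, OF cb] holding_cong[of n c b, OF cb] by simp_all
    then have "feasible (Suc n) c" "\<not> holding c (Suc n)"
      by (simp_all add: feasible_def c_def atLeastAtMostSuc_conv)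
    moreover have "total_reward n c p = total_reward n b p"
      by (auto simp: total_reward_def cb intro!: sum.cong)
    then have "total_reward (Suc n) c p = total_reward n b p"
      by (simp add: total_reward_def c_def)
    moreover have "reward (a (Suc n)) (p (Suc n)) \<le> 0"
      using True Suc.prems(1)[of "Suc n"] by (cases "a (Suc n)") auto
    then have "total_reward (Suc n) a p \<le> total_reward n a p"
      by (simp add: total_reward_def)
    ultimately show ?thesis using b(3) by (intro exI[of _ c]) simp
  qed
qed

lemma OPT_nonneg:
  assumes "\<And>i. i \<in> {1..n} \<Longrightarrow> 0 \<le> p i"
  shows "OPT n p = Max ((\<lambda>a. total_reward n a p) ` {a. feasible n a})"
proof -
  have ne: "feasible n (\<lambda>_. Pass)" by (simp add: feasible_def)
  have nh: "\<not> holding (\<lambda>_. Pass) n" by (induction n) auto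
  show ?thesis unfolding OPT_def
  proof (rule antisym)
    show "Max ((\<lambda>a. total_reward n a p) ` {a. feasible n a \<and> \<not> holding a n})
        \<le> Max ((\<lambda>a. total_reward n a p) ` {a. feasible n a})"
      using ne nh by (intro Max_mono finite_total_reward) auto
    show "Max ((\<lambda>a. total_reward n a p) ` {a. feasible n a})
        \<le> Max ((\<lambda>a. total_reward n a p) ` {a. feasible n a \<and> \<not> holding a n})"
    proof (rule Max.boundedI)
      fix x assume "x \<in> (\<lambda>a. total_reward n a p) ` {a. feasible n a}"
      then obtain a where a: "feasible n a" "x = total_reward n a p" by auto
      with drop_unsold_item[of n p a] assms obtain b
        where b: "feasible n b" "\<not> holding b n" "x \<le> total_reward n b p" by auto
      then show "x \<le> Max ((\<lambda>a. total_reward n a p) ` {a. feasible n a \<and> \<not> holding a n})"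
        by (intro order_trans[OF b(3)] Max_ge finite_total_reward) auto
    qed (use ne in \<open>auto intro: finite_total_reward\<close>)
  qed
qed


section \<open>Random order\<close>

definition perms :: "nat \<Rightarrow> (nat \<Rightarrow> nat) set" where
  "perms n = {\<pi>. \<pi> permutes {1..n}}"

text \<open>
  The distributions have finite means; this holds if and only if \<open>OPT\<close> has a finite expectation.
  Independence of the order and the prices is spelled out as independence of the generated
  \<open>\<sigma>\<close>-algebras because \<open>indep_var\<close> requires both random variables to have the same type.
\<close>

locale random_order_prices = prob_space M for M :: "'a measure" +
  fixes n :: nat and X :: "nat \<Rightarrow> 'a \<Rightarrow> real" and \<sigma> :: "'a \<Rightarrow> nat \<Rightarrow> nat"
  assumes two_periods: "n \<ge> 2"
    and indep_prices: "indep_vars (\<lambda>_. borel) X {1..n}"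
    and abs_cont: "\<And>i. i \<in> {1..n} \<Longrightarrow> absolutely_continuous lborel (distr M borel (X i))"
    and finite_mean: "\<And>i. i \<in> {1..n} \<Longrightarrow> integrable M (X i)"
    and order_rv: "random_variable (count_space (perms n)) \<sigma>"
    and uniform_order: "distr M (count_space (perms n)) \<sigma> = uniform_count_measure (perms n)"
    and indep_order:
      "indep_set
         (sigma_sets (space M) {(\<lambda>\<omega>. \<lambda>i\<in>{1..n}. X i \<omega>) -` A \<inter> space M | A.
            A \<in> sets (PiM {1..n} (\<lambda>_. borel))})
         (sigma_sets (space M) {\<sigma> -` B \<inter> space M | B. B \<in> sets (count_space (perms n))})"

definition price_seq :: "(nat \<Rightarrow> 'a \<Rightarrow> real) \<Rightarrow> ('a \<Rightarrow> nat \<Rightarrow> nat) \<Rightarrow> 'a \<Rightarrow> nat \<Rightarrow> real" where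
  "price_seq X \<sigma> \<omega> i = X (\<sigma> \<omega> i) \<omega>"

definition expected_ALG ::
  "'a measure \<Rightarrow> nat \<Rightarrow> (nat \<Rightarrow> 'a \<Rightarrow> real) \<Rightarrow> ('a \<Rightarrow> nat \<Rightarrow> nat) \<Rightarrow> real \<Rightarrow> real" where
  "expected_ALG M n X \<sigma> T = (\<integral>\<omega>. ALG n T (price_seq X \<sigma> \<omega>) \<partial>M)"

definition expected_OPT ::
  "'a measure \<Rightarrow> nat \<Rightarrow> (nat \<Rightarrow> 'a \<Rightarrow> real) \<Rightarrow> ('a \<Rightarrow> nat \<Rightarrow> nat) \<Rightarrow> real" where
  "expected_OPT M n X \<sigma> = (\<integral>\<omega>. OPT n (price_seq X \<sigma> \<omega>) \<partial>M)"


section \<open>Real-RAM computations with access to the price distributions\<close>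

text \<open>
  Continuous distributions are not finite inputs, so running time is counted for programs of a
  real random access machine which access the distributions through queries. The machine has
  index registers (natural numbers) and an array of real cells; a real cell is always addressed
  through an index register holding its address. Arithmetic on reals is exact, constants are
  rational, and there is no rounding operation. The \<open>i\<close>-th distribution can be queried for its
  mean, for its cdf at a point and for a quantile. Every instruction, query and test takes one
  time unit.
\<close>

definition quantile :: "real measure \<Rightarrow> real \<Rightarrow> real" where
  "quantile \<mu> q = (if 0 < q \<and> q < 1 then Inf {x. q \<le> cdf \<mu> x} else 0)"

datatype arith = Plus | Minus | Times | Divide

fun arith_op :: "arith \<Rightarrow> real \<Rightarrow> real \<Rightarrow> real" where
  "arith_op Plus x y = x + y"
| "arith_op Minus x y = x - y"
| "arith_op Times x y = x * y"
| "arith_op Divide x y = x / y"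

datatype instr =
    Set_Index nat nat
  | Add_Index nat nat nat
  | Sub_Index nat nat nat
  | Set_Real nat rat
  | Copy_Real nat nat
  | Arith_Real arith nat nat nat
  | Query_Mean nat nat
  | Query_Cdf nat nat nat
  | Query_Quantile nat nat nat

datatype test = Index_Less nat nat | Real_Less nat nat

datatype program =
    Do instr
  | Seq program program
  | Cond test program program
  | Loop test program

type_synonym state = "(nat \<Rightarrow> nat) \<times> (nat \<Rightarrow> real)"

fun step :: "(nat \<Rightarrow> real measure) \<Rightarrow> instr \<Rightarrow> state \<Rightarrow> state" where
  "step D (Set_Index k c) (N, R) = (N(k := c), R)"
| "step D (Add_Index k i j) (N, R) = (N(k := N i + N j), R)"
| "step D (Sub_Index k i j) (N, R) = (N(k := N i - N j), R)"
| "step D (Set_Real k c) (N, R) = (N, R(N k := of_rat c))"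
| "step D (Copy_Real k i) (N, R) = (N, R(N k := R (N i)))"
| "step D (Arith_Real f k i j) (N, R) = (N, R(N k := arith_op f (R (N i)) (R (N j))))"
| "step D (Query_Mean k i) (N, R) = (N, R(N k := (\<integral>x. x \<partial>D (N i))))"
| "step D (Query_Cdf k i j) (N, R) = (N, R(N k := cdf (D (N i)) (R (N j))))"
| "step D (Query_Quantile k i j) (N, R) = (N, R(N k := quantile (D (N i)) (R (N j))))"

fun test_true :: "test \<Rightarrow> state \<Rightarrow> bool" where
  "test_true (Index_Less i j) (N, R) \<longleftrightarrow> N i < N j"
| "test_true (Real_Less i j) (N, R) \<longleftrightarrow> R (N i) < R (N j)"

text \<open>\<open>exec D P s t s'\<close>: started in \<open>s\<close>, program \<open>P\<close> halts in \<open>s'\<close> after exactly \<open>t\<close> time units.\<close>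

inductive exec :: "(nat \<Rightarrow> real measure) \<Rightarrow> program \<Rightarrow> state \<Rightarrow> nat \<Rightarrow> state \<Rightarrow> bool"
  for D where
  Do: "exec D (Do i) s 1 (step D i s)"
| Seq: "exec D P s t s' \<Longrightarrow> exec D Q s' u s'' \<Longrightarrow> exec D (Seq P Q) s (t + u) s''"
| Cond_True: "test_true b s \<Longrightarrow> exec D P s t s' \<Longrightarrow> exec D (Cond b P Q) s (1 + t) s'"
| Cond_False: "\<not> test_true b s \<Longrightarrow> exec D Q s t s' \<Longrightarrow> exec D (Cond b P Q) s (1 + t) s'"
| Loop_True: "test_true b s \<Longrightarrow> exec D P s t s' \<Longrightarrow> exec D (Loop b P) s' u s'' \<Longrightarrow>
    exec D (Loop b P) s (1 + t + u) s''"
| Loop_False: "\<not> test_true b s \<Longrightarrow> exec D (Loop b P) s 1 s"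

text \<open>
  The number \<open>n\<close> of distributions is given in index register 0, all other registers and cells are
  initially 0, and the result is read from real cell 0.
\<close>

definition computes_in_time ::
  "program \<Rightarrow> nat \<Rightarrow> (nat \<Rightarrow> real measure) \<Rightarrow> nat \<Rightarrow> real \<Rightarrow> bool" where
  "computes_in_time P n D t T \<longleftrightarrow>
     (\<exists>N R. exec D P ((\<lambda>_. 0)(0 := n), \<lambda>_. 0) t (N, R) \<and> R 0 = T)"

end

theory Submission
  imports Defs
begin

text \<open>
  \<open>ALG\<^sub>T\<close> holds the item after period \<open>i < n\<close> iff \<open>p\<^sub>i < T\<close>, so its profit is the sum of \<open>p\<^sub>i\<^sub>+\<^sub>1 - p\<^sub>i\<close> over
  these periods, while \<open>OPT\<close> is at most the sum of the positive parts of \<open>p\<^sub>i\<^sub>+\<^sub>1 - p\<^sub>i\<close>. In random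
  order both expectations become sums over ordered pairs of distinct prices, with the same factor.
  With \<open>L\<^sub>j = E (T - X\<^sub>j)\<^sup>+\<close>, \<open>U\<^sub>j = E (X\<^sub>j - T)\<^sup>+\<close> and \<open>q\<^sub>i = P (X\<^sub>i < T)\<close>, the pair sum of \<open>ALG\<^sub>T\<close> is
  \<open>\<Sum>\<^sub>j (L\<^sub>j \<Sum>\<^sub>i\<^sub>\<noteq>\<^sub>j (1 - q\<^sub>i) + U\<^sub>j \<Sum>\<^sub>i\<^sub>\<noteq>\<^sub>j q\<^sub>i)\<close>, and that of \<open>OPT\<close> is at most \<open>(n - 1) \<Sum>\<^sub>j (L\<^sub>j + U\<^sub>j)\<close>.
  Take for \<open>T\<close> a median of the medians of the prices. If \<open>n \<ge> 3\<close>, every inner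
  sum is at least \<open>(n - 1) / 16\<close>.

  If \<open>n = 2\<close>, then \<open>T\<close> is the median of one price \<open>X\<^sub>k\<close>, and one of the two coefficients belonging to
  \<open>X\<^sub>k\<close> may vanish. Let \<open>T\<close> be the smaller median if the two means add up to at most the sum of the two
  medians, and the larger one otherwise. In the first case \<open>U\<^sub>k\<close> is the uncontrolled term, and
  \<open>U\<^sub>k - L\<^sub>k = E X\<^sub>k - T \<le> m\<^sub>l - E X\<^sub>l \<le> U\<^sub>l + L\<^sub>l\<close> for the other price \<open>X\<^sub>l\<close> and its median \<open>m\<^sub>l\<close>,
  because \<open>m\<^sub>l - T \<le> 2 U\<^sub>l\<close>. The second case is symmetric.
\<close>

section \<open>Profits as sums over consecutive periods\<close>

lemma total_reward_eq:
  assumes "feasible n a"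
  shows "total_reward n a p + (if holding a n then p n else 0)
    = (\<Sum>i<n. if holding a i then p (Suc i) - p i else 0)"
  using assms
proof (induction n)
  case 0
  then show ?case by (simp add: total_reward_def)
next
  case (Suc n)
  have "feasible n a" using Suc.prems by (auto simp: feasible_def)
  note IH = Suc.IH[OF this]
  have *: "a (Suc n) = Buy \<longrightarrow> \<not> holding a n" "a (Suc n) = Sell \<longrightarrow> holding a n"
    using Suc.prems by (auto simp: feasible_def)
  have "total_reward (Suc n) a p = total_reward n a p + reward (a (Suc n)) (p (Suc n))"
    by (simp add: total_reward_def)
  then show ?case using IH * by (cases "a (Suc n)") (auto split: if_splits)
qed

lemma sum_holding_shift:
  "(\<Sum>i<n. if holding a i then f i else (0::real)) = (\<Sum>i\<in>{1..<n}. if holding a i then f i else 0)"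
proof (rule sum.mono_neutral_right)
  show "\<forall>i\<in>{..<n} - {1..<n}. (if holding a i then f i else 0) = 0"
  proof
    fix i assume "i \<in> {..<n} - {1..<n}"
    then have "i = 0" by auto
    then show "(if holding a i then f i else 0) = 0" by simp
  qed
qed auto

lemma OPT_le: "OPT n p \<le> (\<Sum>i\<in>{1..<n}. max 0 (p (Suc i) - p i))"
  unfolding OPT_def
proof (rule Max.boundedI)
  have "feasible n (\<lambda>_. Pass)" by (simp add: feasible_def)
  moreover have "\<not> holding (\<lambda>_. Pass) n" by (induction n) auto
  ultimately show "(\<lambda>a. total_reward n a p) ` {a. feasible n a \<and> \<not> holding a n} \<noteq> {}" by blast
next
  fix x assume "x \<in> (\<lambda>a. total_reward n a p) ` {a. feasible n a \<and> \<not> holding a n}"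
  then obtain a where a: "feasible n a" "\<not> holding a n" "x = total_reward n a p" by auto
  then have "x = (\<Sum>i\<in>{1..<n}. if holding a i then p (Suc i) - p i else 0)"
    using total_reward_eq[of n a p] sum_holding_shift[of a "\<lambda>i. p (Suc i) - p i" n] by simp
  also have "\<dots> \<le> (\<Sum>i\<in>{1..<n}. max 0 (p (Suc i) - p i))"
    by (intro sum_mono) auto
  finally show "x \<le> (\<Sum>i\<in>{1..<n}. max 0 (p (Suc i) - p i))" .
qed (rule finite_total_reward)

lemma threshold_holding_iff:
  assumes "1 \<le> i" "i < n"
  shows "threshold_holding n T p i \<longleftrightarrow> p i < T"
  using assms by (cases i) (auto simp: threshold_step_def)

lemma not_threshold_holding_end: "\<not> threshold_holding n T p n"
  by (cases n) (auto simp: threshold_step_def)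

lemma ALG_eq: "ALG n T p = (\<Sum>i\<in>{1..<n}. if p i < T then p (Suc i) - p i else 0)"
proof -
  have "ALG n T p = (\<Sum>i\<in>{1..<n}. if threshold_holding n T p i then p (Suc i) - p i else 0)"
    using total_reward_eq[OF feasible_threshold_actions, of n T p p]
      sum_holding_shift[of "threshold_actions n T p" "\<lambda>i. p (Suc i) - p i" n]
    by (simp add: ALG_def holding_threshold_actions not_threshold_holding_end)
  also have "\<dots> = (\<Sum>i\<in>{1..<n}. if p i < T then p (Suc i) - p i else 0)"
    by (intro sum.cong) (auto simp: threshold_holding_iff)
  finally show ?thesis .
qed


section \<open>Permutations and medians of finite families\<close>

lemma ex_permutes_pair:
  assumes "a \<in> S" "b \<in> S" "a \<noteq> b" "a' \<in> S" "b' \<in> S" "a' \<noteq> b'"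
  shows "\<exists>\<tau>. \<tau> permutes S \<and> \<tau> a = a' \<and> \<tau> b = b'"
proof -
  define c where "c = Transposition.transpose a a' b"
  have c: "c \<in> S" "c \<noteq> a'" using assms by (auto simp: c_def Transposition.transpose_def)
  define \<tau> where "\<tau> = Transposition.transpose c b' \<circ> Transposition.transpose a a'"
  have "\<tau> permutes S" unfolding \<tau>_def
    using assms c by (intro permutes_compose permutes_swap_id) auto
  moreover have "\<tau> a = a'" "\<tau> b = b'" using assms c by (auto simp: \<tau>_def c_def[symmetric])
  ultimately show ?thesis by blast
qed

lemma card_permutes_pair:
  assumes "finite S" "a \<in> S" "b \<in> S" "a \<noteq> b" "a' \<in> S" "b' \<in> S" "a' \<noteq> b'"
  shows "card {\<pi>. \<pi> permutes S \<and> \<pi> i = a \<and> \<pi> j = b} \<le> card {\<pi>. \<pi> permutes S \<and> \<pi> i = a' \<and> \<pi> j = b'}"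
proof -
  obtain \<tau> where \<tau>: "\<tau> permutes S" "\<tau> a = a'" "\<tau> b = b'"
    using ex_permutes_pair assms by metis
  show ?thesis
  proof (rule card_inj_on_le[of "\<lambda>\<pi>. \<tau> \<circ> \<pi>"])
    show "inj_on ((\<circ>) \<tau>) {\<pi>. \<pi> permutes S \<and> \<pi> i = a \<and> \<pi> j = b}"
      using fun.inj_map[OF permutes_inj[OF \<tau>(1)]] by (rule inj_on_subset) simp
    show "(\<circ>) \<tau> ` {\<pi>. \<pi> permutes S \<and> \<pi> i = a \<and> \<pi> j = b} \<subseteq> {\<pi>. \<pi> permutes S \<and> \<pi> i = a' \<and> \<pi> j = b'}"
      using \<tau> by (auto intro: permutes_compose)
    show "finite {\<pi>. \<pi> permutes S \<and> \<pi> i = a' \<and> \<pi> j = b'}"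
      by (rule finite_subset[OF _ finite_permutations[OF assms(1)]]) auto
  qed
qed

lemma sum_permutes_pair:
  assumes "finite S" "i \<in> S" "j \<in> S" "i \<noteq> j"
  shows "\<exists>c\<ge>0. \<forall>G::'a \<Rightarrow> 'a \<Rightarrow> real.
    (\<Sum>\<pi> | \<pi> permutes S. G (\<pi> i) (\<pi> j)) = c * (\<Sum>a\<in>S. \<Sum>b\<in>S - {a}. G a b)"
proof -
  let ?P = "\<lambda>a b. {\<pi>. \<pi> permutes S \<and> \<pi> i = a \<and> \<pi> j = b}"
  let ?D = "SIGMA a:S. S - {a}"
  define c where "c = card (?P i j)"
  have c: "card (?P a b) = c" if "a \<in> S" "b \<in> S" "a \<noteq> b" for a b
    unfolding c_def using that assms by (intro antisym card_permutes_pair) auto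
  have "(\<Sum>\<pi> | \<pi> permutes S. G (\<pi> i) (\<pi> j)) = real c * (\<Sum>a\<in>S. \<Sum>b\<in>S - {a}. G a b)"
    for G :: "'a \<Rightarrow> 'a \<Rightarrow> real"
  proof -
    have fin: "finite {\<pi>. \<pi> permutes S}" using assms(1) by (rule finite_permutations)
    have "(\<Sum>\<pi> | \<pi> permutes S. G (\<pi> i) (\<pi> j))
      = (\<Sum>d\<in>?D. \<Sum>\<pi>\<in>{\<pi>\<in>{\<pi>. \<pi> permutes S}. (\<pi> i, \<pi> j) = d}. G (\<pi> i) (\<pi> j))"
    proof (rule sum.group[symmetric, OF fin])
      show "finite ?D" using assms(1) by auto
      show "(\<lambda>\<pi>. (\<pi> i, \<pi> j)) ` {\<pi>. \<pi> permutes S} \<subseteq> ?D"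
        using assms by (auto simp: permutes_in_image dest: permutes_inj injD)
    qed
    also have "\<dots> = (\<Sum>d\<in>?D. real c * G (fst d) (snd d))"
    proof (rule sum.cong[OF refl])
      fix d assume "d \<in> ?D"
      then obtain a b where d: "d = (a, b)" "a \<in> S" "b \<in> S" "a \<noteq> b" by auto
      have "{\<pi>\<in>{\<pi>. \<pi> permutes S}. (\<pi> i, \<pi> j) = d} = ?P a b" using d by auto
      moreover have "(\<Sum>\<pi>\<in>?P a b. G (\<pi> i) (\<pi> j)) = (\<Sum>\<pi>\<in>?P a b. G a b)" by (intro sum.cong) auto
      ultimately show "(\<Sum>\<pi>\<in>{\<pi>\<in>{\<pi>. \<pi> permutes S}. (\<pi> i, \<pi> j) = d}. G (\<pi> i) (\<pi> j))
        = real c * G (fst d) (snd d)" using c d by simp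
    qed
    also have "\<dots> = real c * (\<Sum>a\<in>S. \<Sum>b\<in>S - {a}. G a b)"
      using assms(1) by (subst sum.Sigma) (auto simp: sum_distrib_left split_beta)
    finally show ?thesis .
  qed
  then show ?thesis by (intro exI[of _ "real c"]) simp
qed

lemma ex_lower_median:
  fixes f :: "'b \<Rightarrow> real"
  assumes "finite S" "S \<noteq> {}"
  shows "\<exists>i\<in>S. 2 * card {j\<in>S. f j < f i} < card S \<and> 2 * card {j\<in>S. f i < f j} \<le> card S"
proof -
  define lt where "lt i = {j\<in>S. f j < f i}" for i
  define gt where "gt i = {j\<in>S. f i < f j}" for i
  define A where "A = {i\<in>S. 2 * card (lt i) < card S}"
  have ex_min: "\<exists>k\<in>B. \<forall>j\<in>B. g k \<le> g j" if "B \<subseteq> S" "B \<noteq> {}" for B and g :: "'b \<Rightarrow> real"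
  proof -
    have "finite (g ` B)" using finite_subset[OF that(1) assms(1)] by simp
    then have "Min (g ` B) \<in> g ` B" "\<forall>j\<in>B. Min (g ` B) \<le> g j" using that(2) by auto
    then show ?thesis by (metis imageE)
  qed
  obtain k where k: "k \<in> S" "\<forall>j\<in>S. f k \<le> f j" using ex_min[of S f] assms by auto
  then have "lt k = {}" by (auto simp: lt_def not_less)
  then have "k \<in> A" using k assms by (simp add: A_def card_gt_0_iff)
  moreover have "A \<subseteq> S" by (auto simp: A_def)
  ultimately obtain i where i: "i \<in> A" "\<forall>j\<in>A. - f i \<le> - f j"
    using ex_min[of A "\<lambda>x. - f x"] by auto
  have "2 * card (gt i) \<le> card S"
  proof (cases "gt i = {}")
    case False
    then obtain k where k: "k \<in> gt i" "\<forall>j\<in>gt i. f k \<le> f j"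
      using ex_min[of "gt i" f] by (auto simp: gt_def)
    have "k \<notin> A" using i(2) k(1) by (auto simp: gt_def)
    then have "card S \<le> 2 * card (lt k)" using k(1) by (auto simp: A_def gt_def)
    moreover have "lt k \<subseteq> S - gt i" using k(2) by (auto simp: lt_def)
    then have "card (lt k) \<le> card (S - gt i)" using assms by (intro card_mono) auto
    moreover have "gt i \<subseteq> S" by (auto simp: gt_def)
    then have "card (S - gt i) = card S - card (gt i)" "card (gt i) \<le> card S"
      using assms by (auto intro: card_Diff_subset card_mono finite_subset)
    ultimately show ?thesis by linarith
  qed simp
  then show ?thesis using i(1) unfolding A_def lt_def gt_def by blast
qed

lemma ex_upper_median:
  fixes f :: "'b \<Rightarrow> real"
  assumes "finite S" "S \<noteq> {}"
  shows "\<exists>i\<in>S. 2 * card {j\<in>S. f j < f i} \<le> card S \<and> 2 * card {j\<in>S. f i < f j} < card S"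
  using ex_lower_median[OF assms, of "\<lambda>x. - f x"] by auto


section \<open>A program that selects a median of medians\<close>

fun block :: "instr \<Rightarrow> instr list \<Rightarrow> program" where
  "block i [] = Do i"
| "block i (j # js) = Seq (Do i) (block j js)"

lemma exec_block: "exec D (block i js) s (Suc (length js)) (fold (step D) (i # js) s)"
proof (induction js arbitrary: i s)
  case Nil
  show ?case using exec.Do[of D i s] by simp
next
  case (Cons j js)
  show ?case using exec.Seq[OF exec.Do Cons.IH[of j "step D i s"]] by simp
qed

definition halts where
  "halts D A P b B \<longleftrightarrow> (\<forall>s. A s \<longrightarrow> (\<exists>t s'. t \<le> b \<and> exec D P s t s' \<and> B s'))"

lemma halts_block:
  assumes "\<And>N R. A (N, R) \<Longrightarrow> B (fold (step D) (i # js) (N, R))"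
  shows "halts D A (block i js) (Suc (length js)) B"
  unfolding halts_def
proof (intro allI impI)
  fix s assume "A s"
  then have "B (fold (step D) (i # js) s)" using assms by (cases s) blast
  then show "\<exists>t s'. t \<le> Suc (length js) \<and> exec D (block i js) s t s' \<and> B s'"
    using exec_block by blast
qed

lemma halts_Seq:
  assumes "halts D A P b B" "halts D B Q c E"
  shows "halts D A (Seq P Q) (b + c) E"
  unfolding halts_def
proof (intro allI impI)
  fix s assume "A s"
  then obtain t s' where 1: "t \<le> b" "exec D P s t s'" "B s'" using assms(1) unfolding halts_def by blast
  then obtain u s'' where 2: "u \<le> c" "exec D Q s' u s''" "E s''" using assms(2) unfolding halts_def by blast
  have "t + u \<le> b + c" using 1 2 by linarith
  then show "\<exists>t s'. t \<le> b + c \<and> exec D (Seq P Q) s t s' \<and> E s'" using 1 2 exec.Seq by blast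
qed

lemma halts_Cond:
  assumes "halts D (\<lambda>s. A s \<and> test_true e s) P b B" "halts D (\<lambda>s. A s \<and> \<not> test_true e s) Q c B"
  shows "halts D A (Cond e P Q) (1 + b + c) B"
  unfolding halts_def
proof (intro allI impI)
  fix s assume "A s"
  show "\<exists>t s'. t \<le> 1 + b + c \<and> exec D (Cond e P Q) s t s' \<and> B s'"
  proof (cases "test_true e s")
    case True
    then obtain t s' where "t \<le> b" "exec D P s t s'" "B s'"
      using assms(1) \<open>A s\<close> unfolding halts_def by blast
    then show ?thesis using exec.Cond_True[OF True, of D P t s' Q]
      by (intro exI[of _ "1 + t"] exI[of _ s']) linarith
  next
    case False
    then obtain t s' where "t \<le> c" "exec D Q s t s'" "B s'"
      using assms(2) \<open>A s\<close> unfolding halts_def by blast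
    then show ?thesis using exec.Cond_False[OF False, of D Q t s' P]
      by (intro exI[of _ "1 + t"] exI[of _ s']) linarith
  qed
qed

lemma halts_Loop:
  assumes body: "\<And>i. i < m \<Longrightarrow> halts D (I i) P b (I (Suc i))"
    and test: "\<And>i s. i \<le> m \<Longrightarrow> I i s \<Longrightarrow> test_true e s \<longleftrightarrow> i < m"
  shows "halts D (I 0) (Loop e P) (1 + m * (1 + b)) (I m)"
proof -
  have "halts D (I i) (Loop e P) (1 + (m - i) * (1 + b)) (I m)" if "i \<le> m" for i
    using that
  proof (induction rule: inc_induct)
    case base
    then show ?case unfolding halts_def
      using exec.Loop_False test[of m] by fastforce
  next
    case (step i)
    show ?case unfolding halts_def
    proof (intro allI impI)
      fix s assume s: "I i s"
      obtain t s' where 1: "t \<le> b" "exec D P s t s'" "I (Suc i) s'"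
        using body[of i] step s unfolding halts_def by blast
      obtain u s'' where 2: "u \<le> 1 + (m - Suc i) * (1 + b)" "exec D (Loop e P) s' u s''" "I m s''"
        using step.IH 1 unfolding halts_def by blast
      have "test_true e s" using test[of i s] s step by simp
      then have "exec D (Loop e P) s (1 + t + u) s''" using exec.Loop_True 1 2 by blast
      moreover have "m - i = Suc (m - Suc i)" using step by simp
      then have "1 + t + u \<le> 1 + (m - i) * (1 + b)" using 1 2 by simp
      ultimately show "\<exists>t s'. t \<le> 1 + (m - i) * (1 + b) \<and> exec D (Loop e P) s t s' \<and> I m s'"
        using 2 by blast
    qed
  qed
  from this[of 0] show ?thesis by simp
qed

lemma halts_conseq:
  assumes "halts D A P b B" "\<And>N R. A' (N, R) \<Longrightarrow> A (N, R)" "\<And>N R. B (N, R) \<Longrightarrow> B' (N, R)" "b \<le> b'"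
  shows "halts D A' P b' B'"
  using assms unfolding halts_def by (metis order_trans surj_pair)

text \<open>
  Index registers: 0 holds \<open>n\<close>, 6 holds \<open>n + 1\<close>, and 10, 5, 7, 8, 9 hold the cell addresses 0, 1, 2, 3, 4.
  The candidate \<open>i\<close> is in 1, the inner loop index \<open>j\<close> in 2, the bit \<open>\<beta>\<close> that selects the lower (\<open>\<beta> = 1\<close>) or
  upper (\<open>\<beta> = 0\<close>) median of medians in 11, its complement in 12, and 3 and 4 hold \<open>\<beta>\<close> and \<open>1 - \<beta>\<close> plus
  twice the number of smaller and larger medians. Writing to 13 does nothing.
  Cell 1 holds \<open>1 / 2\<close>, cell 4 stays 0.
\<close>

definition init_block :: program where
  "init_block = block (Set_Index 5 1)
     [Set_Index 7 2, Set_Index 8 3, Set_Index 9 4, Add_Index 6 0 5, Set_Real 5 (1 / 2),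
      Query_Mean 7 5, Query_Quantile 8 5 5, Arith_Real Minus 7 7 8,
      Query_Mean 8 7, Arith_Real Plus 7 7 8, Query_Quantile 8 7 5, Arith_Real Minus 7 7 8]"

definition side_block :: program where
  "side_block = Seq (Cond (Real_Less 9 7) (block (Set_Index 11 0) []) (block (Set_Index 11 1) []))
     (block (Sub_Index 12 5 11) [Set_Index 1 1])"

definition count_body :: program where
  "count_body = Seq (block (Query_Quantile 8 2 5) [])
     (Seq (Cond (Real_Less 8 7) (block (Add_Index 3 3 7) [])
        (Cond (Real_Less 7 8) (block (Add_Index 4 4 7) []) (block (Set_Index 13 0) [])))
      (block (Add_Index 2 2 5) []))"

definition select_body :: program where
  "select_body = Seq (block (Query_Quantile 7 1 5) [Add_Index 3 11 10, Add_Index 4 12 10, Set_Index 2 1])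
     (Seq (Loop (Index_Less 2 6) count_body)
     (Seq (Cond (Index_Less 3 6)
        (Cond (Index_Less 4 6) (block (Copy_Real 10 7) []) (block (Set_Index 13 0) []))
        (block (Set_Index 13 0) []))
      (block (Add_Index 1 1 5) [])))"

definition median_program :: program where
  "median_program = Seq init_block (Seq side_block (Loop (Index_Less 1 6) select_body))"

definition med :: "real measure \<Rightarrow> real" where "med \<mu> = quantile \<mu> (1 / 2)"

definition side :: "(nat \<Rightarrow> real measure) \<Rightarrow> nat" where
  "side D = (if (\<integral>x. x \<partial>D 1) + (\<integral>x. x \<partial>D 2) \<le> med (D 1) + med (D 2) then 1 else 0)"

text \<open>The arguments \<open>\<beta> = 1\<close> and \<open>\<beta> = 0\<close> stand for lower and upper medians; \<open>1 - \<beta>\<close> is truncated for other \<open>\<beta>\<close>.\<close>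

definition central :: "nat \<Rightarrow> (nat \<Rightarrow> real) \<Rightarrow> nat \<Rightarrow> nat \<Rightarrow> bool" where
  "central n m \<beta> i \<longleftrightarrow> \<beta> + 2 * card {j\<in>{1..n}. m j < m i} \<le> n
     \<and> 1 - \<beta> + 2 * card {j\<in>{1..n}. m i < m j} \<le> n"

lemma ex_central:
  assumes "n \<ge> 1" "\<beta> = 0 \<or> \<beta> = 1"
  shows "\<exists>i\<in>{1..n}. central n m \<beta> i"
  using assms ex_lower_median[of "{1..n}" m] ex_upper_median[of "{1..n}" m]
  unfolding central_def by (elim disjE) (auto simp: Suc_le_eq)

definition base_inv :: "nat \<Rightarrow> nat \<Rightarrow> state \<Rightarrow> bool" where
  "base_inv n \<beta> s = (case s of (N, R) \<Rightarrow> N 0 = n \<and> N 5 = 1 \<and> N 6 = Suc n \<and> N 7 = 2 \<and> N 8 = 3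
     \<and> N 10 = 0 \<and> N 11 = \<beta> \<and> N 12 = 1 - \<beta> \<and> (\<forall>\<mu>. quantile \<mu> (R 1) = med \<mu>))"

definition found :: "nat \<Rightarrow> (nat \<Rightarrow> real) \<Rightarrow> nat \<Rightarrow> nat \<Rightarrow> real \<Rightarrow> bool" where
  "found n m \<beta> i r \<longleftrightarrow> (\<exists>k\<in>{1..i}. central n m \<beta> k) \<longrightarrow> (\<exists>k\<in>{1..i}. central n m \<beta> k \<and> r = m k)"

definition select_inv :: "nat \<Rightarrow> (nat \<Rightarrow> real) \<Rightarrow> nat \<Rightarrow> nat \<Rightarrow> state \<Rightarrow> bool" where
  "select_inv n m \<beta> i s = (case s of (N, R) \<Rightarrow> base_inv n \<beta> (N, R) \<and> N 1 = Suc i \<and> found n m \<beta> i (R 0))"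

definition count_inv :: "nat \<Rightarrow> (nat \<Rightarrow> real) \<Rightarrow> nat \<Rightarrow> nat \<Rightarrow> nat \<Rightarrow> state \<Rightarrow> bool" where
  "count_inv n m \<beta> i j s = (case s of (N, R) \<Rightarrow> select_inv n m \<beta> i (N, R) \<and> N 2 = Suc j \<and> R 2 = m (Suc i)
     \<and> N 3 = \<beta> + 2 * card {k\<in>{1..j}. m k < m (Suc i)}
     \<and> N 4 = 1 - \<beta> + 2 * card {k\<in>{1..j}. m (Suc i) < m k})"

lemma card_Collect_le_Suc:
  "card {k. Suc 0 \<le> k \<and> k \<le> Suc j \<and> Q k}
    = card {k. Suc 0 \<le> k \<and> k \<le> j \<and> Q k} + (if Q (Suc j) then 1 else 0)"
proof -
  have "{k. Suc 0 \<le> k \<and> k \<le> Suc j \<and> Q k}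
      = (if Q (Suc j) then insert (Suc j) {k. Suc 0 \<le> k \<and> k \<le> j \<and> Q k}
         else {k. Suc 0 \<le> k \<and> k \<le> j \<and> Q k})"
    by (auto simp: le_Suc_eq)
  then show ?thesis by simp
qed

lemmas inv_defs = base_inv_def select_inv_def count_inv_def

lemma count_body_halts:
  "halts D (count_inv n (\<lambda>i. med (D i)) \<beta> i j) count_body 7 (count_inv n (\<lambda>i. med (D i)) \<beta> i (Suc j))"
proof -
  let ?m = "\<lambda>i. med (D i)"
  let ?A = "count_inv n ?m \<beta> i j"
  let ?B = "\<lambda>(N, R). ?A (N, R) \<and> R 3 = ?m (Suc j)"
  let ?C = "\<lambda>(N, R). count_inv n ?m \<beta> i (Suc j) (N(2 := Suc (Suc j)), R) \<and> N 2 = Suc j"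
  have 1: "halts D ?A (block (Query_Quantile 8 2 5) []) (Suc (length ([]::instr list))) ?B"
    by (rule halts_block) (auto simp: inv_defs)
  have 2: "halts D (\<lambda>s. ?B s \<and> test_true (Real_Less 8 7) s) (block (Add_Index 3 3 7) [])
      (Suc (length ([]::instr list))) ?C"
    by (rule halts_block) (auto simp: inv_defs card_Collect_le_Suc)
  have 3: "halts D (\<lambda>s. (?B s \<and> \<not> test_true (Real_Less 8 7) s) \<and> test_true (Real_Less 7 8) s)
      (block (Add_Index 4 4 7) []) (Suc (length ([]::instr list))) ?C"
    by (rule halts_block) (auto simp: inv_defs card_Collect_le_Suc)
  have 4: "halts D (\<lambda>s. (?B s \<and> \<not> test_true (Real_Less 8 7) s) \<and> \<not> test_true (Real_Less 7 8) s)
      (block (Set_Index 13 0) []) (Suc (length ([]::instr list))) ?C"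
    by (rule halts_block) (auto simp: inv_defs card_Collect_le_Suc)
  have 5: "halts D ?C (block (Add_Index 2 2 5) []) (Suc (length ([]::instr list)))
      (count_inv n ?m \<beta> i (Suc j))"
    by (rule halts_block) (auto simp: inv_defs)
  show ?thesis unfolding count_body_def
    by (rule halts_conseq[OF halts_Seq[OF 1 halts_Seq[OF halts_Cond[OF 2 halts_Cond[OF 3 4]] 5]]]) auto
qed

lemma found_Suc_central: "central n m \<beta> (Suc i) \<Longrightarrow> found n m \<beta> (Suc i) (m (Suc i))"
  unfolding found_def by force

lemma found_Suc_not_central: "\<not> central n m \<beta> (Suc i) \<Longrightarrow> found n m \<beta> i r \<Longrightarrow> found n m \<beta> (Suc i) r"
  unfolding found_def by (metis atLeastAtMost_iff le_Suc_eq)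

lemma select_body_halts:
  "halts D (select_inv n (\<lambda>i. med (D i)) \<beta> i) select_body (11 + 8 * n)
     (select_inv n (\<lambda>i. med (D i)) \<beta> (Suc i))"
proof -
  let ?m = "\<lambda>i. med (D i)"
  let ?A = "select_inv n ?m \<beta> i"
  let ?B = "count_inv n ?m \<beta> i"
  let ?C = "\<lambda>(N, R). select_inv n ?m \<beta> (Suc i) (N(1 := Suc (Suc i)), R) \<and> N 1 = Suc i"
  have 1: "halts D ?A (block (Query_Quantile 7 1 5) [Add_Index 3 11 10, Add_Index 4 12 10, Set_Index 2 1])
      (Suc (length [Add_Index 3 11 10, Add_Index 4 12 10, Set_Index 2 1])) (?B 0)"
    by (rule halts_block) (auto simp: inv_defs)
  have 2: "halts D (?B 0) (Loop (Index_Less 2 6) count_body) (1 + n * (1 + 7)) (?B n)"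
    by (rule halts_Loop[where I = "?B"]) (rule count_body_halts, auto simp: inv_defs)
  have 3: "halts D (\<lambda>s. (?B n s \<and> test_true (Index_Less 3 6) s) \<and> test_true (Index_Less 4 6) s)
      (block (Copy_Real 10 7) []) (Suc (length ([]::instr list))) ?C"
    by (rule halts_block)
      (auto simp: inv_defs less_Suc_eq_le intro!: found_Suc_central simp: central_def)
  have 4: "halts D (\<lambda>s. (?B n s \<and> test_true (Index_Less 3 6) s) \<and> \<not> test_true (Index_Less 4 6) s)
      (block (Set_Index 13 0) []) (Suc (length ([]::instr list))) ?C"
    by (rule halts_block)
      (auto simp: inv_defs less_Suc_eq_le intro!: found_Suc_not_central simp: central_def)
  have 5: "halts D (\<lambda>s. ?B n s \<and> \<not> test_true (Index_Less 3 6) s)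
      (block (Set_Index 13 0) []) (Suc (length ([]::instr list))) ?C"
    by (rule halts_block)
      (auto simp: inv_defs less_Suc_eq_le intro!: found_Suc_not_central simp: central_def)
  have 6: "halts D ?C (block (Add_Index 1 1 5) []) (Suc (length ([]::instr list)))
      (select_inv n ?m \<beta> (Suc i))"
    by (rule halts_block) (auto simp: inv_defs)
  show ?thesis unfolding select_body_def
    by (rule halts_conseq[OF halts_Seq[OF 1 halts_Seq[OF 2 halts_Seq[OF halts_Cond[OF halts_Cond[OF 3 4] 5] 6]]]]) auto
qed

lemma median_program_halts:
  "halts D (\<lambda>s. s = ((\<lambda>_. 0)(0 := n), \<lambda>_. 0)) median_program (19 + n * (12 + 8 * n))
     (select_inv n (\<lambda>i. med (D i)) (side D) n)"
proof -
  let ?m = "\<lambda>i. med (D i)"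
  let ?A = "\<lambda>s. s = ((\<lambda>_. 0)(0 := n), \<lambda>_. 0)"
  let ?S = "(\<integral>x. x \<partial>D 1) - med (D 1) + (\<integral>x. x \<partial>D 2) - med (D 2)"
  let ?B = "\<lambda>(N, R). base_inv n (N 11) (N(12 := 1 - N 11), R) \<and> N 9 = 4 \<and> R 2 = ?S \<and> R 4 = 0"
  let ?C = "\<lambda>(N, R). base_inv n (side D) (N(12 := 1 - side D), R)"
  have 1: "halts D ?A init_block 13 ?B"
    unfolding init_block_def
    by (rule halts_conseq[OF halts_block[where A = ?A and B = ?B]])
      (auto simp: inv_defs med_def of_rat_divide)
  have 2: "halts D (\<lambda>s. ?B s \<and> test_true (Real_Less 9 7) s) (block (Set_Index 11 0) [])
      (Suc (length ([]::instr list))) ?C"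
    by (rule halts_block) (auto simp: inv_defs side_def)
  have 3: "halts D (\<lambda>s. ?B s \<and> \<not> test_true (Real_Less 9 7) s) (block (Set_Index 11 1) [])
      (Suc (length ([]::instr list))) ?C"
    by (rule halts_block) (auto simp: inv_defs side_def)
  have 4: "halts D ?C (block (Sub_Index 12 5 11) [Set_Index 1 1]) (Suc (length [Set_Index 1 1]))
      (select_inv n ?m (side D) 0)"
    by (rule halts_block) (auto simp: inv_defs found_def)
  have 5: "halts D (select_inv n ?m (side D) 0) (Loop (Index_Less 1 6) select_body)
      (1 + n * (1 + (11 + 8 * n))) (select_inv n ?m (side D) n)"
    by (rule halts_Loop[where I = "select_inv n ?m (side D)"]) (rule select_body_halts, auto simp: inv_defs)
  show ?thesis unfolding median_program_def side_block_def
    by (rule halts_conseq[OF halts_Seq[OF 1 halts_Seq[OF halts_Seq[OF halts_Cond[OF 2 3] 4] 5]]]) auto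
qed

lemma median_program_computes:
  assumes "n \<ge> 1"
  shows "\<exists>i\<in>{1..n}. \<exists>t \<le> 39 * n ^ 2. central n (\<lambda>i. med (D i)) (side D) i
    \<and> computes_in_time median_program n D t (med (D i))"
proof -
  obtain t N R where t: "t \<le> 19 + n * (12 + 8 * n)"
    "exec D median_program ((\<lambda>_. 0)(0 := n), \<lambda>_. 0) t (N, R)"
    "select_inv n (\<lambda>i. med (D i)) (side D) n (N, R)"
    using median_program_halts[of D n] unfolding halts_def by (metis surj_pair)
  have "found n (\<lambda>i. med (D i)) (side D) n (R 0)" using t(3) by (simp add: inv_defs)
  then obtain i where i: "i \<in> {1..n}" "central n (\<lambda>i. med (D i)) (side D) i" "R 0 = med (D i)"
    using ex_central[OF assms, of "side D" "\<lambda>i. med (D i)"] unfolding found_def side_def by auto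
  have "n \<le> n ^ 2" "1 \<le> n ^ 2" using assms by (auto simp: power2_eq_square)
  moreover have "19 + n * (12 + 8 * n) = 19 + 12 * n + 8 * n ^ 2"
    by (simp add: algebra_simps power2_eq_square)
  ultimately have "t \<le> 39 * n ^ 2" using t(1) by linarith
  then show ?thesis using i t(2) unfolding computes_in_time_def by blast
qed


section \<open>Prices in random order\<close>

lemma (in real_distribution) measure_lessThan_med:
  assumes "\<And>x. measure M {x} = 0"
  shows "measure M {..<med M} = 1 / 2"
proof -
  have cont: "isCont (cdf M) x" for x using isCont_cdf assms by blast
  have ev: "eventually (\<lambda>x. cdf M x < 1 / 2) at_bot" "eventually (\<lambda>x. 1 / 2 < cdf M x) at_top"
    using order_tendstoD(2)[OF cdf_lim_at_bot, of "1 / 2"]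
      order_tendstoD(1)[OF cdf_lim_at_top_prob, of "1 / 2"] by auto
  obtain l u where lu: "\<And>x. x \<le> l \<Longrightarrow> cdf M x < 1 / 2" "\<And>x. u \<le> x \<Longrightarrow> 1 / 2 < cdf M x"
    using ev unfolding eventually_at_bot_linorder eventually_at_top_linorder by blast
  have "l \<le> u" using lu(1)[of l] lu(2)[of "max l u"] by (smt (verit) lu)
  then obtain z where z: "cdf M z = 1 / 2"
    using IVT'[of "cdf M" l "1 / 2" u] lu cont
    by (metis continuous_at_imp_continuous_on less_eq_real_def order_refl)
  define S where "S = {x. 1 / 2 \<le> cdf M x}"
  have med: "med M = Inf S" by (simp add: med_def quantile_def S_def)
  have S: "z \<in> S" "bdd_below S" using z lu(1)
    by (auto simp: S_def intro!: bdd_belowI[of _ l]) (meson linorder_not_le nle_le)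
  have "closed S" unfolding S_def
    using cont by (intro closed_Collect_le continuous_intros) (simp add: continuous_at_imp_continuous_on)
  then have "med M \<in> S" unfolding med using S closed_contains_Inf by blast
  moreover have "cdf M (med M) \<le> cdf M z"
    unfolding med by (intro cdf_nondecreasing cInf_lower S)
  ultimately have "cdf M (med M) = 1 / 2" using z by (simp add: S_def)
  moreover have "cdf M (med M) = measure M {..<med M} + measure M {med M}"
    unfolding cdf_def2 ivl_disj_un_singleton(2)[symmetric] by (rule finite_measure_Union) auto
  ultimately show ?thesis using assms by simp
qed

context random_order_prices
begin

lemma rv_X [measurable]: "i \<in> {1..n} \<Longrightarrow> random_variable borel (X i)"
  using indep_prices by (auto simp: indep_vars_def)

lemma indep_pair:
  assumes "i \<in> {1..n}" "j \<in> {1..n}" "i \<noteq> j"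
  shows "indep_var borel (X i) borel (X j)"
proof -
  have "indep_var borel ((\<lambda>f. f i) \<circ> (\<lambda>\<omega>. restrict (\<lambda>k. X k \<omega>) {i}))
      borel ((\<lambda>f. f j) \<circ> (\<lambda>\<omega>. restrict (\<lambda>k. X k \<omega>) {j}))"
    using assms by (intro indep_var_compose[OF indep_var_restrict[OF indep_prices]]) auto
  then show ?thesis by (simp add: comp_def)
qed

lemma finite_perms: "finite (perms n)" unfolding perms_def by (rule finite_permutations) simp

lemma order_in_perms: "\<omega> \<in> space M \<Longrightarrow> \<sigma> \<omega> \<in> perms n"
  using measurable_space[OF order_rv] by simp

lemma prob_order: "\<pi> \<in> perms n \<Longrightarrow> prob {\<omega>\<in>space M. \<sigma> \<omega> = \<pi>} = 1 / card (perms n)"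
proof -
  assume \<pi>: "\<pi> \<in> perms n"
  have "prob (\<sigma> -` {\<pi>} \<inter> space M) = measure (distr M (count_space (perms n)) \<sigma>) {\<pi>}"
    using \<pi> by (intro measure_distr[symmetric] order_rv) simp
  also have "\<dots> = 1 / card (perms n)"
    unfolding uniform_order using \<pi> finite_perms by (subst measure_uniform_count_measure) auto
  also have "\<sigma> -` {\<pi>} \<inter> space M = {\<omega>\<in>space M. \<sigma> \<omega> = \<pi>}" by auto
  finally show ?thesis .
qed

lemma indep_prices_order:
  fixes f :: "(nat \<Rightarrow> real) \<Rightarrow> real" and g :: "(nat \<Rightarrow> nat) \<Rightarrow> real"
  assumes f: "f \<in> borel_measurable (PiM {1..n} (\<lambda>_. borel))"
  shows "indep_var borel (\<lambda>\<omega>. f (\<lambda>i\<in>{1..n}. X i \<omega>)) borel (\<lambda>\<omega>. g (\<sigma> \<omega>))"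
proof -
  let ?V = "\<lambda>\<omega>. \<lambda>i\<in>{1..n}. X i \<omega>"
  have V: "?V \<in> measurable M (PiM {1..n} (\<lambda>_. borel))" by (intro measurable_restrict rv_X)
  have fV: "random_variable borel (\<lambda>\<omega>. f (?V \<omega>))" using f V by (rule measurable_compose[rotated])
  have g: "g \<in> borel_measurable (count_space (perms n))" by simp
  have gs: "random_variable borel (\<lambda>\<omega>. g (\<sigma> \<omega>))" using g order_rv by (rule measurable_compose[rotated])
  have 1: "sigma_sets (space M) {(\<lambda>\<omega>. f (?V \<omega>)) -` A \<inter> space M | A. A \<in> sets borel}
    \<subseteq> sigma_sets (space M) {?V -` A \<inter> space M | A. A \<in> sets (PiM {1..n} (\<lambda>_. borel))}"
  proof (intro sigma_sets_mono subsetI, clarify)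
    fix A :: "real set" assume "A \<in> sets borel"
    then have "f -` A \<inter> space (PiM {1..n} (\<lambda>_. borel)) \<in> sets (PiM {1..n} (\<lambda>_. borel))"
      using f by (rule measurable_sets[rotated])
    moreover have "(\<lambda>\<omega>. f (?V \<omega>)) -` A \<inter> space M
        = ?V -` (f -` A \<inter> space (PiM {1..n} (\<lambda>_. borel))) \<inter> space M"
      using measurable_space[OF V] by auto
    ultimately show "(\<lambda>\<omega>. f (?V \<omega>)) -` A \<inter> space M
        \<in> sigma_sets (space M) {?V -` A \<inter> space M | A. A \<in> sets (PiM {1..n} (\<lambda>_. borel))}"
      by (intro sigma_sets.Basic) blast
  qed
  have 2: "sigma_sets (space M) {(\<lambda>\<omega>. g (\<sigma> \<omega>)) -` A \<inter> space M | A. A \<in> sets borel}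
    \<subseteq> sigma_sets (space M) {\<sigma> -` B \<inter> space M | B. B \<in> sets (count_space (perms n))}"
  proof (intro sigma_sets_mono subsetI, clarify)
    fix A :: "real set"
    have "(\<lambda>\<omega>. g (\<sigma> \<omega>)) -` A \<inter> space M = \<sigma> -` (g -` A \<inter> perms n) \<inter> space M"
      using order_in_perms by auto
    then show "(\<lambda>\<omega>. g (\<sigma> \<omega>)) -` A \<inter> space M
        \<in> sigma_sets (space M) {\<sigma> -` B \<inter> space M | B. B \<in> sets (count_space (perms n))}"
      by (intro sigma_sets.Basic CollectI exI[of _ "g -` A \<inter> perms n"]) simp
  qed
  have "indep_set (sigma_sets (space M) {(\<lambda>\<omega>. f (?V \<omega>)) -` A \<inter> space M | A. A \<in> sets borel})
      (sigma_sets (space M) {(\<lambda>\<omega>. g (\<sigma> \<omega>)) -` A \<inter> space M | A. A \<in> sets borel})"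
    using indep_order unfolding indep_set_def
    by (rule indep_sets_mono_sets) (use 1 2 in \<open>auto split: bool.split\<close>)
  with fV gs show ?thesis unfolding indep_var_eq by blast
qed

lemma expectation_random_order:
  assumes meas: "\<And>\<pi>. \<pi> \<in> perms n \<Longrightarrow> (\<lambda>p. h (p \<circ> \<pi>)) \<in> borel_measurable (PiM {1..n} (\<lambda>_. borel))"
    and coords: "\<And>p p'. (\<And>i. i \<in> {1..n} \<Longrightarrow> p i = p' i) \<Longrightarrow> h p = h p'"
    and int: "\<And>\<pi>. \<pi> \<in> perms n \<Longrightarrow> integrable M (\<lambda>\<omega>. h (\<lambda>i. X (\<pi> i) \<omega>))"
  shows "integrable M (\<lambda>\<omega>. h (price_seq X \<sigma> \<omega>))"
    and "expectation (\<lambda>\<omega>. h (price_seq X \<sigma> \<omega>))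
      = (\<Sum>\<pi>\<in>perms n. expectation (\<lambda>\<omega>. h (\<lambda>i. X (\<pi> i) \<omega>))) / card (perms n)"
proof -
  let ?I = "\<lambda>\<pi> \<omega>. indicat_real {\<pi>} (\<sigma> \<omega>)"
  have eq: "h (price_seq X \<sigma> \<omega>) = (\<Sum>\<pi>\<in>perms n. h (\<lambda>i. X (\<pi> i) \<omega>) * ?I \<pi> \<omega>)"
    if "\<omega> \<in> space M" for \<omega>
  proof -
    have "(\<Sum>\<pi>\<in>perms n. h (\<lambda>i. X (\<pi> i) \<omega>) * ?I \<pi> \<omega>)
      = (\<Sum>\<pi>\<in>perms n. if \<sigma> \<omega> = \<pi> then h (\<lambda>i. X (\<pi> i) \<omega>) else 0)"
      by (intro sum.cong) auto
    also have "\<dots> = h (\<lambda>i. X (\<sigma> \<omega> i) \<omega>)"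
      using order_in_perms[OF that] finite_perms by simp
    finally show ?thesis by (simp add: price_seq_def[abs_def])
  qed
  have indep: "indep_var borel (\<lambda>\<omega>. h (\<lambda>i. X (\<pi> i) \<omega>)) borel (?I \<pi>)" if "\<pi> \<in> perms n" for \<pi>
  proof -
    have "h ((\<lambda>i\<in>{1..n}. X i \<omega>) \<circ> \<pi>) = h (\<lambda>i. X (\<pi> i) \<omega>)" for \<omega>
    proof (rule coords)
      fix i assume "i \<in> {1..n}"
      then have "\<pi> i \<in> {1..n}" using that permutes_in_image[of \<pi> "{1..n}" i] by (simp add: perms_def)
      then show "((\<lambda>i\<in>{1..n}. X i \<omega>) \<circ> \<pi>) i = X (\<pi> i) \<omega>" by simp
    qed
    then show ?thesis using indep_prices_order[OF meas[OF that], of "indicator {\<pi>}"] by simp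
  qed
  have I: "integrable M (?I \<pi>)" "expectation (?I \<pi>) = 1 / card (perms n)" if "\<pi> \<in> perms n" for \<pi>
  proof -
    have s: "{\<omega>\<in>space M. \<sigma> \<omega> = \<pi>} \<in> events"
    proof -
      have "\<sigma> -` {\<pi>} \<inter> space M \<in> events" using order_rv that by (intro measurable_sets) auto
      moreover have "\<sigma> -` {\<pi>} \<inter> space M = {\<omega>\<in>space M. \<sigma> \<omega> = \<pi>}" by auto
      ultimately show ?thesis by simp
    qed
    have e: "?I \<pi> \<omega> = indicator {\<omega>\<in>space M. \<sigma> \<omega> = \<pi>} \<omega>" if "\<omega> \<in> space M" for \<omega>
      using that by (auto simp: indicator_def)
    show "integrable M (?I \<pi>)"
      by (rule Bochner_Integration.integrable_cong[THEN iffD2, OF refl e])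
        (use s in \<open>auto simp: integrable_indicator_iff emeasure_eq_measure\<close>)
    have "expectation (?I \<pi>) = expectation (indicator {\<omega>\<in>space M. \<sigma> \<omega> = \<pi>})"
      by (rule Bochner_Integration.integral_cong[OF refl e])
    also have "\<dots> = 1 / card (perms n)" using s prob_order[OF that] by simp
    finally show "expectation (?I \<pi>) = 1 / card (perms n)" .
  qed
  note prod = indep_var_integrable[OF indep int I(1)] indep_var_lebesgue_integral[OF indep int I(1)]
  show "integrable M (\<lambda>\<omega>. h (price_seq X \<sigma> \<omega>))"
    by (rule Bochner_Integration.integrable_cong[THEN iffD2, OF refl eq]) (use prod in auto)
  have "expectation (\<lambda>\<omega>. h (price_seq X \<sigma> \<omega>))
      = expectation (\<lambda>\<omega>. \<Sum>\<pi>\<in>perms n. h (\<lambda>i. X (\<pi> i) \<omega>) * ?I \<pi> \<omega>)"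
    by (rule Bochner_Integration.integral_cong[OF refl eq])
  also have "\<dots> = (\<Sum>\<pi>\<in>perms n. expectation (\<lambda>\<omega>. h (\<lambda>i. X (\<pi> i) \<omega>) * ?I \<pi> \<omega>))"
    using prod by (intro Bochner_Integration.integral_sum) auto
  also have "\<dots> = (\<Sum>\<pi>\<in>perms n. expectation (\<lambda>\<omega>. h (\<lambda>i. X (\<pi> i) \<omega>))) / card (perms n)"
    using prod I by (simp add: sum_divide_distrib)
  finally show "expectation (\<lambda>\<omega>. h (price_seq X \<sigma> \<omega>))
      = (\<Sum>\<pi>\<in>perms n. expectation (\<lambda>\<omega>. h (\<lambda>i. X (\<pi> i) \<omega>))) / card (perms n)" .
qed

lemma expectation_consecutive:
  "\<exists>K\<ge>0. \<forall>g. (\<lambda>x. g (fst x) (snd x)) \<in> borel_measurable borel \<longrightarrow>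
      (\<forall>a\<in>{1..n}. \<forall>b\<in>{1..n}. integrable M (\<lambda>\<omega>. g (X a \<omega>) (X b \<omega>))) \<longrightarrow>
      integrable M (\<lambda>\<omega>. \<Sum>i\<in>{1..<n}. g (price_seq X \<sigma> \<omega> i) (price_seq X \<sigma> \<omega> (Suc i)))
      \<and> expectation (\<lambda>\<omega>. \<Sum>i\<in>{1..<n}. g (price_seq X \<sigma> \<omega> i) (price_seq X \<sigma> \<omega> (Suc i)))
        = K * (\<Sum>a\<in>{1..n}. \<Sum>b\<in>{1..n} - {a}. expectation (\<lambda>\<omega>. g (X a \<omega>) (X b \<omega>) :: real))"
proof -
  have "\<forall>i\<in>{1..<n}. \<exists>c\<ge>0. \<forall>G::nat \<Rightarrow> nat \<Rightarrow> real. (\<Sum>\<pi>\<in>perms n. G (\<pi> i) (\<pi> (Suc i)))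
      = c * (\<Sum>a\<in>{1..n}. \<Sum>b\<in>{1..n} - {a}. G a b)"
    unfolding perms_def by (intro ballI sum_permutes_pair) auto
  from bchoice[OF this] obtain c where c: "\<And>i. i \<in> {1..<n} \<Longrightarrow> 0 \<le> c i"
    "\<And>i (G::nat \<Rightarrow> nat \<Rightarrow> real). i \<in> {1..<n} \<Longrightarrow> (\<Sum>\<pi>\<in>perms n. G (\<pi> i) (\<pi> (Suc i)))
      = c i * (\<Sum>a\<in>{1..n}. \<Sum>b\<in>{1..n} - {a}. G a b)" by blast
  show ?thesis
  proof (intro exI[of _ "(\<Sum>i\<in>{1..<n}. c i) / card (perms n)"] conjI allI impI)
    show "0 \<le> (\<Sum>i\<in>{1..<n}. c i) / card (perms n)" using c(1) by (intro divide_nonneg_nonneg sum_nonneg) auto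
  next
    fix g :: "real \<Rightarrow> real \<Rightarrow> real"
    assume g: "(\<lambda>x. g (fst x) (snd x)) \<in> borel_measurable borel"
      and int: "\<forall>a\<in>{1..n}. \<forall>b\<in>{1..n}. integrable M (\<lambda>\<omega>. g (X a \<omega>) (X b \<omega>))"
    define h where "h p = (\<Sum>i\<in>{1..<n}. g (p i) (p (Suc i)))" for p
    have perm: "\<pi> k \<in> {1..n}" if "\<pi> \<in> perms n" "k \<in> {1..n}" for \<pi> k
      using that by (simp only: perms_def mem_Collect_eq permutes_in_image)
    have img: "\<pi> i \<in> {1..n}" "\<pi> (Suc i) \<in> {1..n}" if "\<pi> \<in> perms n" "i \<in> {1..<n}" for \<pi> i
    proof -
      have "i \<in> {1..n}" "Suc i \<in> {1..n}" using that(2) by auto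
      then show "\<pi> i \<in> {1..n}" "\<pi> (Suc i) \<in> {1..n}" using perm[OF that(1)] by blast+
    qed
    have 1: "(\<lambda>p. h (p \<circ> \<pi>)) \<in> borel_measurable (PiM {1..n} (\<lambda>_. borel))" if "\<pi> \<in> perms n" for \<pi>
      unfolding h_def
    proof (rule borel_measurable_sum)
      fix i assume i: "i \<in> {1..<n}"
      have "(\<lambda>p :: nat \<Rightarrow> real. (p (\<pi> i), p (\<pi> (Suc i)))) \<in> measurable (PiM {1..n} (\<lambda>_. borel)) (borel \<Otimes>\<^sub>M borel)"
        using img[OF that i] by (intro measurable_Pair measurable_component_singleton)
      then have "(\<lambda>p. (p (\<pi> i), p (\<pi> (Suc i)))) \<in> measurable (PiM {1..n} (\<lambda>_. borel)) (borel :: (real \<times> real) measure)"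
        by (simp only: borel_prod)
      from measurable_compose[OF this g]
      show "(\<lambda>p. g ((p \<circ> \<pi>) i) ((p \<circ> \<pi>) (Suc i))) \<in> borel_measurable (PiM {1..n} (\<lambda>_. borel))" by simp
    qed
    have 2: "h p = h p'" if "\<And>i. i \<in> {1..n} \<Longrightarrow> p i = p' i" for p p'
      unfolding h_def using that by (intro sum.cong) auto
    have 3: "integrable M (\<lambda>\<omega>. h (\<lambda>i. X (\<pi> i) \<omega>))" if "\<pi> \<in> perms n" for \<pi>
      unfolding h_def using img[OF that] int by (intro Bochner_Integration.integrable_sum) auto
    have "(\<Sum>\<pi>\<in>perms n. expectation (\<lambda>\<omega>. h (\<lambda>i. X (\<pi> i) \<omega>)))
      = (\<Sum>\<pi>\<in>perms n. \<Sum>i\<in>{1..<n}. expectation (\<lambda>\<omega>. g (X (\<pi> i) \<omega>) (X (\<pi> (Suc i)) \<omega>)))"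
      unfolding h_def using img int by (intro sum.cong[OF refl] Bochner_Integration.integral_sum) auto
    also have "\<dots> = (\<Sum>i\<in>{1..<n}. \<Sum>\<pi>\<in>perms n. expectation (\<lambda>\<omega>. g (X (\<pi> i) \<omega>) (X (\<pi> (Suc i)) \<omega>)))"
      by (rule sum.swap)
    also have "\<dots> = (\<Sum>i\<in>{1..<n}. c i * (\<Sum>a\<in>{1..n}. \<Sum>b\<in>{1..n} - {a}. expectation (\<lambda>\<omega>. g (X a \<omega>) (X b \<omega>))))"
      by (intro sum.cong[OF refl] c(2)[of _ "\<lambda>a b. expectation (\<lambda>\<omega>. g (X a \<omega>) (X b \<omega>))"])
    finally have 4: "(\<Sum>\<pi>\<in>perms n. expectation (\<lambda>\<omega>. h (\<lambda>i. X (\<pi> i) \<omega>)))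
      = (\<Sum>i\<in>{1..<n}. c i) * (\<Sum>a\<in>{1..n}. \<Sum>b\<in>{1..n} - {a}. expectation (\<lambda>\<omega>. g (X a \<omega>) (X b \<omega>)))"
      by (simp add: sum_distrib_right)
    note E = expectation_random_order[of h, OF 1 2 3]
    show "integrable M (\<lambda>\<omega>. \<Sum>i\<in>{1..<n}. g (price_seq X \<sigma> \<omega> i) (price_seq X \<sigma> \<omega> (Suc i)))"
      using E(1) unfolding h_def .
    show "expectation (\<lambda>\<omega>. \<Sum>i\<in>{1..<n}. g (price_seq X \<sigma> \<omega> i) (price_seq X \<sigma> \<omega> (Suc i)))
        = (\<Sum>i\<in>{1..<n}. c i) / card (perms n)
          * (\<Sum>a\<in>{1..n}. \<Sum>b\<in>{1..n} - {a}. expectation (\<lambda>\<omega>. g (X a \<omega>) (X b \<omega>)))"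
      using E(2) unfolding 4 by (simp add: h_def)
  qed
qed

definition low :: "real \<Rightarrow> nat \<Rightarrow> real" where "low T i = expectation (\<lambda>\<omega>. max 0 (T - X i \<omega>))"
definition up :: "real \<Rightarrow> nat \<Rightarrow> real" where "up T i = expectation (\<lambda>\<omega>. max 0 (X i \<omega> - T))"
definition below :: "real \<Rightarrow> nat \<Rightarrow> real" where "below T i = prob {\<omega>\<in>space M. X i \<omega> < T}"
definition median :: "nat \<Rightarrow> real" where "median i = med (distr M borel (X i))"

lemma low_nonneg: "0 \<le> low T i" and up_nonneg: "0 \<le> up T i"
  unfolding low_def up_def by (auto intro!: Bochner_Integration.integral_nonneg)

lemma below_bounds: "0 \<le> below T i" "below T i \<le> 1"
  unfolding below_def by auto

lemma integrable_parts:
  assumes "i \<in> {1..n}"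
  shows "integrable M (\<lambda>\<omega>. max 0 (T - X i \<omega>))" "integrable M (\<lambda>\<omega>. max 0 (X i \<omega> - T))"
  using finite_mean[OF assms] by auto

lemma up_minus_low: "i \<in> {1..n} \<Longrightarrow> up T i - low T i = expectation (X i) - T"
proof -
  assume i: "i \<in> {1..n}"
  have "up T i - low T i = expectation (\<lambda>\<omega>. max 0 (X i \<omega> - T) - max 0 (T - X i \<omega>))"
    unfolding up_def low_def using integrable_parts[OF i] by simp
  also have "\<dots> = expectation (\<lambda>\<omega>. X i \<omega> - T)" by (intro arg_cong[of _ _ expectation] ext) auto
  also have "\<dots> = expectation (X i) - T" using finite_mean[OF i] by (simp add: prob_space)
  finally show ?thesis .
qed

lemma integrable_below:
  assumes "i \<in> {1..n}"
  shows "integrable M (\<lambda>\<omega>. if X i \<omega> < T then 1 else 0 :: real)"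
    "expectation (\<lambda>\<omega>. if X i \<omega> < T then 1 else 0 :: real) = below T i"
proof -
  note [measurable] = rv_X[OF assms]
  have e: "(\<lambda>\<omega>. if X i \<omega> < T then 1 else 0 :: real) \<omega> = indicator {\<omega>\<in>space M. X i \<omega> < T} \<omega>"
    if "\<omega> \<in> space M" for \<omega> using that by auto
  show "integrable M (\<lambda>\<omega>. if X i \<omega> < T then 1 else 0 :: real)"
    by (rule integrable_const_bound[of _ 1]) auto
  have "expectation (\<lambda>\<omega>. if X i \<omega> < T then 1 else 0 :: real) = expectation (indicator {\<omega>\<in>space M. X i \<omega> < T})"
    by (rule Bochner_Integration.integral_cong[OF refl e])
  then show "expectation (\<lambda>\<omega>. if X i \<omega> < T then 1 else 0 :: real) = below T i"
    by (simp add: below_def)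
qed

lemma expectation_trade:
  assumes "i \<in> {1..n}" "j \<in> {1..n}" "i \<noteq> j"
  shows "expectation (\<lambda>\<omega>. if X i \<omega> < T then X j \<omega> - X i \<omega> else 0)
    = low T i + below T i * (up T j - low T j)"
proof -
  let ?I = "\<lambda>\<omega>. if X i \<omega> < T then 1 else 0 :: real"
  have "indep_var borel ((\<lambda>x. if x < T then 1 else 0 :: real) \<circ> X i) borel ((\<lambda>x. x - T) \<circ> X j)"
    by (rule indep_var_compose[OF indep_pair[OF assms]]) auto
  then have ind: "indep_var borel ?I borel (\<lambda>\<omega>. X j \<omega> - T)" by (simp add: comp_def)
  have int: "integrable M (\<lambda>\<omega>. X j \<omega> - T)" using finite_mean[OF assms(2)] by simp
  note prod = indep_var_integrable[OF ind integrable_below(1)[OF assms(1)] int]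
    indep_var_lebesgue_integral[OF ind integrable_below(1)[OF assms(1)] int]
  have "expectation (\<lambda>\<omega>. if X i \<omega> < T then X j \<omega> - X i \<omega> else 0)
    = expectation (\<lambda>\<omega>. max 0 (T - X i \<omega>) + ?I \<omega> * (X j \<omega> - T))"
    by (intro arg_cong[of _ _ expectation] ext) auto
  also have "\<dots> = low T i + expectation (\<lambda>\<omega>. ?I \<omega> * (X j \<omega> - T))"
    unfolding low_def using integrable_parts[OF assms(1)] prod(1) by simp
  also have "expectation (\<lambda>\<omega>. ?I \<omega> * (X j \<omega> - T)) = below T i * (up T j - low T j)"
    unfolding prod(2) integrable_below(2)[OF assms(1)] up_minus_low[OF assms(2)]
    using finite_mean[OF assms(2)] by (simp add: prob_space)
  finally show ?thesis .
qed

lemma expectation_positive_part_le: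
  assumes "i \<in> {1..n}" "j \<in> {1..n}"
  shows "expectation (\<lambda>\<omega>. max 0 (X j \<omega> - X i \<omega>)) \<le> low T i + up T j"
proof -
  have "expectation (\<lambda>\<omega>. max 0 (X j \<omega> - X i \<omega>))
    \<le> expectation (\<lambda>\<omega>. max 0 (T - X i \<omega>) + max 0 (X j \<omega> - T))"
    using integrable_parts assms finite_mean by (intro integral_mono) auto
  also have "\<dots> = low T i + up T j"
    unfolding low_def up_def using integrable_parts assms by simp
  finally show ?thesis .
qed

lemma below_median:
  assumes i: "i \<in> {1..n}"
  shows "below (median i) i = 1 / 2"
proof -
  interpret D: real_distribution "distr M borel (X i)" using rv_X[OF i] by simp
  have "measure (distr M borel (X i)) {x} = 0" for x
  proof -
    have "{x} \<in> null_sets lborel" by (simp add: null_sets_def)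
    then have "{x} \<in> null_sets (distr M borel (X i))"
      using abs_cont[OF i] unfolding absolutely_continuous_def by blast
    then show ?thesis by (simp add: null_sets_def measure_def)
  qed
  then have "measure (distr M borel (X i)) {..<median i} = 1 / 2"
    unfolding median_def by (rule D.measure_lessThan_med)
  moreover have "measure (distr M borel (X i)) {..<median i} = prob (X i -` {..<median i} \<inter> space M)"
    using rv_X[OF i] by (intro measure_distr) auto
  moreover have "X i -` {..<median i} \<inter> space M = {\<omega>\<in>space M. X i \<omega> < median i}" by auto
  ultimately show ?thesis by (simp add: below_def)
qed

lemma below_mono: "i \<in> {1..n} \<Longrightarrow> S \<le> T \<Longrightarrow> below S i \<le> below T i"
proof -
  assume "i \<in> {1..n}" "S \<le> T"
  note [measurable] = rv_X[OF this(1)]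
  show ?thesis unfolding below_def using \<open>S \<le> T\<close> by (intro finite_measure_mono) auto
qed

lemma below_ge_half: "i \<in> {1..n} \<Longrightarrow> median i \<le> T \<Longrightarrow> 1 / 2 \<le> below T i"
  using below_median below_mono by metis

lemma below_le_half: "i \<in> {1..n} \<Longrightarrow> T \<le> median i \<Longrightarrow> below T i \<le> 1 / 2"
  using below_median below_mono by metis

lemma median_minus_le_up:
  assumes i: "i \<in> {1..n}"
  shows "median i - T \<le> 2 * up T i"
proof -
  have "(median i - T) * (1 / 2) = expectation (\<lambda>\<omega>. (median i - T) * (1 - (if X i \<omega> < median i then 1 else 0)))"
    using integrable_below[OF i, of "median i"] below_median[OF i] by (simp add: prob_space)
  also have "\<dots> \<le> up T i" unfolding up_def
    using integrable_below(1)[OF i, of "median i"] integrable_parts[OF i] by (intro integral_mono) auto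
  finally show ?thesis by simp
qed

lemma minus_median_le_low:
  assumes i: "i \<in> {1..n}"
  shows "T - median i \<le> 2 * low T i"
proof -
  have "(T - median i) * (1 / 2) = expectation (\<lambda>\<omega>. (T - median i) * (if X i \<omega> < median i then 1 else 0))"
    using integrable_below[OF i, of "median i"] below_median[OF i] by simp
  also have "\<dots> \<le> low T i" unfolding low_def
    using integrable_below(1)[OF i, of "median i"] integrable_parts[OF i] by (intro integral_mono) auto
  finally show ?thesis by simp
qed

definition trade_sum :: "real \<Rightarrow> real" where
  "trade_sum T = (\<Sum>j\<in>{1..n}. low T j * (\<Sum>i\<in>{1..n} - {j}. 1 - below T i)
     + up T j * (\<Sum>i\<in>{1..n} - {j}. below T i))"

lemma sum_swap_distinct:
  "(\<Sum>i\<in>{1..n}. \<Sum>j\<in>{1..n} - {i}. f i j) = (\<Sum>j\<in>{1..n}. \<Sum>i\<in>{1..n} - {j}. f i j)" for f :: "nat \<Rightarrow> nat \<Rightarrow> real"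
proof -
  have "(\<Sum>i\<in>{1..n}. \<Sum>j | j \<in> {1..n} \<and> i \<noteq> j. f i j) = (\<Sum>j\<in>{1..n}. \<Sum>i | i \<in> {1..n} \<and> i \<noteq> j. f i j)"
    by (rule sum.swap_restrict) auto
  moreover have "{j. j \<in> {1..n} \<and> i \<noteq> j} = {1..n} - {i}" "{j. j \<in> {1..n} \<and> j \<noteq> i} = {1..n} - {i}" for i by auto
  ultimately show ?thesis by simp
qed

lemma sum_expectation_trade:
  "(\<Sum>i\<in>{1..n}. \<Sum>j\<in>{1..n} - {i}. expectation (\<lambda>\<omega>. if X i \<omega> < T then X j \<omega> - X i \<omega> else 0)) = trade_sum T"
proof -
  have "(\<Sum>i\<in>{1..n}. \<Sum>j\<in>{1..n} - {i}. expectation (\<lambda>\<omega>. if X i \<omega> < T then X j \<omega> - X i \<omega> else 0))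
    = (\<Sum>i\<in>{1..n}. \<Sum>j\<in>{1..n} - {i}. low T i) + (\<Sum>i\<in>{1..n}. \<Sum>j\<in>{1..n} - {i}. below T i * (up T j - low T j))"
    unfolding sum.distrib[symmetric] using expectation_trade by (intro sum.cong) auto
  also have "\<dots> = (\<Sum>j\<in>{1..n}. \<Sum>i\<in>{1..n} - {j}. low T j + below T i * (up T j - low T j))"
    by (subst (2) sum_swap_distinct) (simp add: sum.distrib)
  also have "\<dots> = trade_sum T"
    unfolding trade_sum_def sum_distrib_left sum.distrib[symmetric]
    by (intro sum.cong) (auto simp: algebra_simps)
  finally show ?thesis .
qed

lemma sum_expectation_positive_part_le:
  "(\<Sum>i\<in>{1..n}. \<Sum>j\<in>{1..n} - {i}. expectation (\<lambda>\<omega>. max 0 (X j \<omega> - X i \<omega>)))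
    \<le> (\<Sum>j\<in>{1..n}. real (n - 1) * (low T j + up T j))"
proof -
  have "(\<Sum>i\<in>{1..n}. \<Sum>j\<in>{1..n} - {i}. expectation (\<lambda>\<omega>. max 0 (X j \<omega> - X i \<omega>)))
    \<le> (\<Sum>i\<in>{1..n}. \<Sum>j\<in>{1..n} - {i}. low T i + up T j)"
    using expectation_positive_part_le by (intro sum_mono) auto
  also have "\<dots> = (\<Sum>i\<in>{1..n}. \<Sum>j\<in>{1..n} - {i}. low T i) + (\<Sum>i\<in>{1..n}. \<Sum>j\<in>{1..n} - {i}. up T j)"
    by (simp add: sum.distrib)
  also have "\<dots> = (\<Sum>j\<in>{1..n}. real (n - 1) * (low T j + up T j))"
    by (subst (2) sum_swap_distinct) (simp add: sum.distrib distrib_left)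
  finally show ?thesis .
qed

lemma expected_OPT_le:
  assumes "(\<Sum>j\<in>{1..n}. real (n - 1) * (low T j + up T j)) \<le> 16 * trade_sum T"
  shows "1 / 16 * expected_OPT M n X \<sigma> \<le> expected_ALG M n X \<sigma> T"
proof -
  obtain K where "0 \<le> K" and K: "\<And>g. (\<lambda>x. g (fst x) (snd x)) \<in> borel_measurable borel \<Longrightarrow>
      (\<And>a b. a \<in> {1..n} \<Longrightarrow> b \<in> {1..n} \<Longrightarrow> integrable M (\<lambda>\<omega>. g (X a \<omega>) (X b \<omega>))) \<Longrightarrow>
      integrable M (\<lambda>\<omega>. \<Sum>i\<in>{1..<n}. g (price_seq X \<sigma> \<omega> i) (price_seq X \<sigma> \<omega> (Suc i)))
      \<and> expectation (\<lambda>\<omega>. \<Sum>i\<in>{1..<n}. g (price_seq X \<sigma> \<omega> i) (price_seq X \<sigma> \<omega> (Suc i)))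
        = K * (\<Sum>a\<in>{1..n}. \<Sum>b\<in>{1..n} - {a}. expectation (\<lambda>\<omega>. g (X a \<omega>) (X b \<omega>) :: real))"
    using expectation_consecutive by blast
  have rv: "integrable M (X i)" "random_variable borel (X i)" if "i \<in> {1..n}" for i
    using that finite_mean rv_X by auto
  have "expected_ALG M n X \<sigma> T = K * trade_sum T"
  proof -
    have int: "integrable M (\<lambda>\<omega>. if X a \<omega> < T then X b \<omega> - X a \<omega> else 0)"
      if "a \<in> {1..n}" "b \<in> {1..n}" for a b
    proof (rule Bochner_Integration.integrable_bound[of _ "\<lambda>\<omega>. X b \<omega> - X a \<omega>"])
      note [measurable] = rv(2)[OF that(1)] rv(2)[OF that(2)]
      show "random_variable borel (\<lambda>\<omega>. if X a \<omega> < T then X b \<omega> - X a \<omega> else 0)" by measurable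
    qed (use rv that in auto)
    have "(\<lambda>x. if fst x < T then snd x - fst x else 0) \<in> borel_measurable (borel :: (real \<times> real) measure)"
      unfolding borel_prod[symmetric] by measurable
    from K[of "\<lambda>x y. if x < T then y - x else 0", OF this int] show ?thesis
      unfolding expected_ALG_def ALG_eq sum_expectation_trade by simp
  qed
  moreover have "expected_OPT M n X \<sigma>
    \<le> K * (\<Sum>a\<in>{1..n}. \<Sum>b\<in>{1..n} - {a}. expectation (\<lambda>\<omega>. max 0 (X b \<omega> - X a \<omega>)))"
  proof -
    have int: "integrable M (\<lambda>\<omega>. max 0 (X b \<omega> - X a \<omega>))" if "a \<in> {1..n}" "b \<in> {1..n}" for a b
      using rv that by auto
    have "(\<lambda>x. max 0 (snd x - fst x)) \<in> borel_measurable (borel :: (real \<times> real) measure)"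
      unfolding borel_prod[symmetric] by measurable
    note k = K[of "\<lambda>x y. max 0 (y - x)", OF this int]
    have "expected_OPT M n X \<sigma>
      \<le> expectation (\<lambda>\<omega>. \<Sum>i\<in>{1..<n}. max 0 (price_seq X \<sigma> \<omega> (Suc i) - price_seq X \<sigma> \<omega> i))"
      unfolding expected_OPT_def using k
      by (intro integral_mono_AE') (auto intro!: OPT_le[simplified] sum_nonneg)
    then show ?thesis using k by simp
  qed
  moreover have "K * (\<Sum>a\<in>{1..n}. \<Sum>b\<in>{1..n} - {a}. expectation (\<lambda>\<omega>. max 0 (X b \<omega> - X a \<omega>)))
    \<le> K * (16 * trade_sum T)"
    using \<open>0 \<le> K\<close> assms sum_expectation_positive_part_le[of T]
    by (intro mult_left_mono) auto
  ultimately show ?thesis by linarith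
qed

lemma trade_sum_ge:
  assumes lo: "\<And>j. j \<in> {1..n} \<Longrightarrow> real (n - 1) \<le> 16 * (\<Sum>i\<in>{1..n} - {j}. 1 - below T i)"
    and hi: "\<And>j. j \<in> {1..n} \<Longrightarrow> real (n - 1) \<le> 16 * (\<Sum>i\<in>{1..n} - {j}. below T i)"
  shows "(\<Sum>j\<in>{1..n}. real (n - 1) * (low T j + up T j)) \<le> 16 * trade_sum T"
  unfolding trade_sum_def sum_distrib_left[of 16]
proof (rule sum_mono)
  fix j assume "j \<in> {1..n}"
  from mult_left_mono[OF lo[OF this] low_nonneg[of T j]] mult_left_mono[OF hi[OF this] up_nonneg[of T j]]
  show "real (n - 1) * (low T j + up T j) \<le> 16 * (low T j * (\<Sum>i\<in>{1..n} - {j}. 1 - below T i)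
     + up T j * (\<Sum>i\<in>{1..n} - {j}. below T i))"
    by (simp add: algebra_simps)
qed

lemma sum_ge_half_card:
  fixes w :: "nat \<Rightarrow> real"
  assumes n: "3 \<le> n" and c: "2 * card {i\<in>{1..n}. \<not> Q i} \<le> n"
    and w: "\<And>i. i \<in> {1..n} \<Longrightarrow> 0 \<le> w i" "\<And>i. i \<in> {1..n} \<Longrightarrow> Q i \<Longrightarrow> 1 / 2 \<le> w i"
    and j: "j \<in> {1..n}"
  shows "real (n - 1) \<le> 16 * (\<Sum>i\<in>{1..n} - {j}. w i)"
proof -
  let ?G = "{i\<in>{1..n}. Q i}" and ?B = "{i\<in>{1..n}. \<not> Q i}"
  have "card (?G \<union> ?B) = card ?G + card ?B" by (rule card_Un_disjoint) auto
  moreover have "?G \<union> ?B = {1..n}" by auto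
  ultimately have G: "card ?G + card ?B = n" by simp
  have "card ?G - 1 \<le> card (?G - {j})" by (simp add: card_Diff_singleton_if)
  with G c n have "n - 1 \<le> 8 * card (?G - {j})" by linarith
  then have "real (n - 1) \<le> 16 * (\<Sum>i\<in>?G - {j}. 1 / 2)" by simp
  also have "(\<Sum>i\<in>?G - {j}. 1 / 2) \<le> (\<Sum>i\<in>?G - {j}. w i)" using w by (intro sum_mono) auto
  also have "\<dots> \<le> (\<Sum>i\<in>{1..n} - {j}. w i)" using w by (intro sum_mono2) auto
  finally show ?thesis by simp
qed

lemma central_threshold_many:
  assumes n: "3 \<le> n" and "central n median \<beta> k"
  shows "(\<Sum>j\<in>{1..n}. real (n - 1) * (low (median k) j + up (median k) j)) \<le> 16 * trade_sum (median k)"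
proof (rule trade_sum_ge)
  let ?T = "median k"
  have c: "2 * card {i\<in>{1..n}. median i < ?T} \<le> n" "2 * card {i\<in>{1..n}. ?T < median i} \<le> n"
    using assms(2) unfolding central_def by auto
  fix j assume j: "j \<in> {1..n}"
  show "real (n - 1) \<le> 16 * (\<Sum>i\<in>{1..n} - {j}. 1 - below ?T i)"
    using c(1) below_le_half below_bounds
    by (intro sum_ge_half_card[OF n _ _ _ j, where Q = "\<lambda>i. ?T \<le> median i"]) (auto simp: not_le)
  show "real (n - 1) \<le> 16 * (\<Sum>i\<in>{1..n} - {j}. below ?T i)"
    using c(2) below_ge_half below_bounds
    by (intro sum_ge_half_card[OF n _ _ _ j, where Q = "\<lambda>i. median i \<le> ?T"]) (auto simp: not_le)
qed

lemma trade_sum_two: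
  assumes "n = 2" "k \<in> {1..n}" "l \<in> {1..n}" "k \<noteq> l"
  shows "trade_sum T = low T k * (1 - below T l) + up T k * below T l + (low T l * (1 - below T k) + up T l * below T k)"
    and "(\<Sum>j\<in>{1..n}. real (n - 1) * (low T j + up T j)) = low T k + up T k + (low T l + up T l)"
proof -
  have s: "{1..n} = {k, l}" using assms by auto
  have d: "{1..n} - {k} = {l}" "{1..n} - {l} = {k}" using assms s by auto
  show "trade_sum T = low T k * (1 - below T l) + up T k * below T l + (low T l * (1 - below T k) + up T l * below T k)"
    unfolding trade_sum_def using d s assms(4) by (simp add: insert_Diff_if)
  show "(\<Sum>j\<in>{1..n}. real (n - 1) * (low T j + up T j)) = low T k + up T k + (low T l + up T l)"
    using s assms by simp
qed

lemma central_threshold_two: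
  assumes n: "n = 2" and k: "k \<in> {1..n}" and central: "central n median (side (\<lambda>i. distr M borel (X i))) k"
  shows "(\<Sum>j\<in>{1..n}. real (n - 1) * (low (median k) j + up (median k) j)) \<le> 16 * trade_sum (median k)"
proof -
  define T where "T = median k"
  define l where "l = 3 - k"
  have "k = 1 \<or> k = 2" using n k by auto
  then have l: "l \<in> {1..n}" "k \<noteq> l" using n unfolding l_def by auto
  note two = trade_sum_two[OF n k l(1,2)]
  have qk: "below T k = 1 / 2" unfolding T_def by (rule below_median[OF k])
  have means: "(\<integral>x. x \<partial>distr M borel (X i)) = expectation (X i)" if "i \<in> {1..n}" for i
    using rv_X[OF that] by (subst integral_distr) auto
  have side: "side (\<lambda>i. distr M borel (X i))
    = (if expectation (X k) + expectation (X l) \<le> median k + median l then 1 else 0)"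
    using n k means[of 1] means[of 2] by (auto simp: side_def median_def l_def numeral_eq_Suc le_Suc_eq add.commute)
  note pos = low_nonneg[of T k] low_nonneg[of T l] up_nonneg[of T k] up_nonneg[of T l]
  note dif = up_minus_low[OF k, of T] up_minus_low[OF l(1), of T]
  define A where "A = low T k * (1 - below T l)"
  define B where "B = up T k * below T l"
  have goal: "low T k + up T k + (low T l + up T l)
    \<le> 16 * (A + B + (low T l * (1 / 2) + up T l * (1 / 2)))"
  proof (cases "expectation (X k) + expectation (X l) \<le> T + median l")
    case True
    then have "2 + 2 * card {j\<in>{1..n}. median j < median k} \<le> Suc n"
      using central side by (simp add: central_def T_def)
    then have "card {j\<in>{1..n}. median j < median k} = 0" using n by linarith
    then have "{j\<in>{1..n}. median j < median k} = {}" by (subst (asm) card_0_eq) auto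
    then have "T \<le> median l" using l(1) by (auto simp: T_def not_less)
    then have "low T k * (1 / 2) \<le> A" "0 \<le> B" unfolding A_def B_def
      using mult_left_mono[OF _ pos(1), of "1 / 2" "1 - below T l"] below_le_half[OF l(1), of T]
        below_bounds(1)[of T l] pos(3) by auto
    moreover have "up T k \<le> low T k + up T l + low T l"
      using True dif median_minus_le_up[OF l(1), of T] by linarith
    ultimately show ?thesis using pos by (simp add: field_simps)
  next
    case False
    then have "2 + 2 * card {j\<in>{1..n}. median k < median j} \<le> Suc n"
      using central side by (simp add: central_def T_def)
    then have "card {j\<in>{1..n}. median k < median j} = 0" using n by linarith
    then have "{j\<in>{1..n}. median k < median j} = {}" by (subst (asm) card_0_eq) auto
    then have "median l \<le> T" using l(1) by (auto simp: T_def not_less)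
    then have "up T k * (1 / 2) \<le> B" "0 \<le> A" unfolding A_def B_def
      using mult_left_mono[OF _ pos(3), of "1 / 2" "below T l"] below_ge_half[OF l(1), of T]
        below_bounds(2)[of T l] pos(1) by auto
    moreover have "low T k \<le> up T k + up T l + low T l"
      using False dif minus_median_le_low[OF l(1), of T] by linarith
    ultimately show ?thesis using pos by (simp add: field_simps)
  qed
  show ?thesis unfolding T_def[symmetric] two qk using goal unfolding A_def B_def by simp
qed

lemma central_threshold:
  assumes "k \<in> {1..n}" "central n median (side (\<lambda>i. distr M borel (X i))) k"
  shows "1 / 16 * expected_OPT M n X \<sigma> \<le> expected_ALG M n X \<sigma> (median k)"
proof (rule expected_OPT_le)
  show "(\<Sum>j\<in>{1..n}. real (n - 1) * (low (median k) j + up (median k) j)) \<le> 16 * trade_sum (median k)"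
    using central_threshold_two[OF _ assms] central_threshold_many[OF _ assms(2)] two_periods
    by (cases "n = 2") auto
qed

lemma median_program_threshold:
  "\<exists>T t. t \<le> 39 * n ^ 2 \<and> computes_in_time median_program n (\<lambda>i. distr M borel (X i)) t T
    \<and> 1 / 16 * expected_OPT M n X \<sigma> \<le> expected_ALG M n X \<sigma> T"
proof -
  obtain k t where "k \<in> {1..n}" "t \<le> 39 * n ^ 2"
    "central n (\<lambda>i. med (distr M borel (X i))) (side (\<lambda>i. distr M borel (X i))) k"
    "computes_in_time median_program n (\<lambda>i. distr M borel (X i)) t (med (distr M borel (X k)))"
    using median_program_computes[of n "\<lambda>i. distr M borel (X i)"] two_periods by auto
  then show ?thesis using central_threshold[of k] unfolding median_def by blast
qed

end

theorem theorem2: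
  shows "(\<forall>(M :: 'a measure) n X \<sigma>. random_order_prices M n X \<sigma> \<longrightarrow>
            (\<exists>T::real. expected_ALG M n X \<sigma> T \<ge> 1 / 16 * expected_OPT M n X \<sigma>))
       \<and> (\<exists>(P :: program) (C :: nat) (k :: nat).
            \<forall>(M :: 'a measure) n X \<sigma>. random_order_prices M n X \<sigma> \<longrightarrow>
              (\<exists>(T::real) t. t \<le> C * n ^ k
                \<and> computes_in_time P n (\<lambda>i. distr M borel (X i)) t T
                \<and> expected_ALG M n X \<sigma> T \<ge> 1 / 16 * expected_OPT M n X \<sigma>))"
proof (intro conjI)
  show "\<forall>(M :: 'a measure) n X \<sigma>. random_order_prices M n X \<sigma> \<longrightarrow>
      (\<exists>T::real. expected_ALG M n X \<sigma> T \<ge> 1 / 16 * expected_OPT M n X \<sigma>)"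
    using random_order_prices.median_program_threshold by blast
  show "\<exists>(P :: program) (C :: nat) (k :: nat).
            \<forall>(M :: 'a measure) n X \<sigma>. random_order_prices M n X \<sigma> \<longrightarrow>
              (\<exists>(T::real) t. t \<le> C * n ^ k
                \<and> computes_in_time P n (\<lambda>i. distr M borel (X i)) t T
                \<and> expected_ALG M n X \<sigma> T \<ge> 1 / 16 * expected_OPT M n X \<sigma>)"
    using random_order_prices.median_program_threshold
    by (intro exI[of _ median_program] exI[of _ 39] exI[of _ 2]) blast
qed

end
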